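(* Let $(X,T)$, $T=(T_1,\ldots,T_r)$, be a multiply generated dynamical system satisfying (DC). Then $(X,T)$ is essentially free if and only if the canonical surjective homomorphism $\pi:G(X,T)\to\mathrm{Germ}(X,T)$ from the semidirect product groupoid to the groupoid of germs is an isomorphism (of topological groupoids).
   Context: Partial maps on a set are composed on the natural domain: $\mathrm{dom}(LR)=\{x\in \mathrm{dom}(R): R(x)\in \mathrm{dom}(L)\}$. Two partial maps $L,R$ commute if $\mathrm{dom}(LR)=\mathrm{dom}(RL)$ and $LR=RL$ on this set. A multiply generated dynamical system (MGDS) is a pair $(X,T)$ where $X$ is a topological space and $T=(T_1,\ldots,T_r)$ is a system of $r$ pairwise commuting partial maps of $X$, each $T_j$ being a local homeomorphism from an open set $\mathrm{dom}(T_j)\subset X$ onto an open set $\mathrm{ran}(T_j)\subset X$. For $n\in\mathbb{N}^r$ put $T^n=T_1^{n_1}\cdots T_r^{n_r}$ (with $T^0=\mathrm{id}$). The domain condition (DC) is: $\mathrm{dom}(T^n)\cap\mathrm{dom}(T^m)\subset\mathrm{dom}(T^{n\vee m})$ for all $m,n\in\mathbb{N}^r$, where $n\vee m$ is the componentwise maximum. $(X,T)$ is essentially free if for every pair of distinct $m,n\in\mathbb{N}^r$ there is no (nonempty) open set on which $T^n$ and $T^m$ (are both defined and) agree. Under (DC) the semidirect product groupoid is $$G(X,T)=\{(x,m-n,y): m,n\in\mathbb{N}^r,\ x\in\mathrm{dom}(T^m),\ y\in\mathrm{dom}(T^n),\ T^mx=T^ny\},$$ with $(x,z,y)(y,z',y')=(x,z+z',y')$,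 $(x,z,y)^{-1}=(y,-z,x)$, and topology with basis the sets $\mathcal{U}(U;m,n;V)=\{(x,m-n,y):(x,y)\in U\times V,\ T^mx=T^ny\}$, where $U$ (resp. $V$) is an open subset of $\mathrm{dom}(T^m)$ (resp. $\mathrm{dom}(T^n)$) on which $T^m$ (resp. $T^n$) is injective. A pseudogroup on $X$ is a set of homeomorphisms between open subsets of $X$ that contains the identity and is closed under composition and inversion; it is full if every homeomorphism between open subsets of $X$ that locally (near every point of its domain) coincides with elements of it belongs to it. $\mathcal{G}(X,T)$ is the full pseudogroup generated by the restrictions $T_j|_U$, where $U$ is an open subset of $X$ on which $T_j$ is (defined and) injective. $\mathrm{Germ}(X,T)$ is the groupoid of germs of $\mathcal{G}(X,T)$: its elements are classes $[x,S,y]$ with $S\in\mathcal{G}(X,T)$, $y\in\mathrm{dom}(S)$, $x=S(y)$, where $[x_1,S_1,y_1]=[x_2,S_2,y_2]$ iff $y_1=y_2$ and $S_1=S_2$ on a neighborhood of $y_1$; the operations are $[x,S,y][y,S',z]=[x,SS',z]$, $[x,S,y]^{-1}=[y,S^{-1},x]$; a basis of the topology is given by the sets $\{[S(y),S,y]:y\in W\}$, $S\in\mathcal{G}(X,T)$, $W\subset\mathrm{dom}(S)$ open. The map $\pi$ is $\pi(x,m-n,y)=[x,(T^m|_U)^{-1}T^n|_V,y]$ for $T^mx=T^ny$, where $U$ is an open neighborhood of $x$ on which $T^m$ is injective and $V$ is an open neighborhood of $y$ on which $T^n$ is injective; it is a well defined continuous surjective groupoid homomorphism. *)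

theory Defs
  imports "HOL-Analysis.Analysis"
begin

section \<open>Partial maps\<close>

text \<open>
  Partial maps of a topological space \<open>X\<close> are maps \<open>'a \<rightharpoonup> 'a\<close> whose domain and range lie in
  \<open>topspace X\<close>. The library composition \<open>L \<circ>\<^sub>m R\<close> has the natural domain
  \<open>{x \<in> dom R. R x \<in> dom L}\<close>, so \<open>L\<close> and \<open>R\<close> commute, equality of domains included,
  iff \<open>L \<circ>\<^sub>m R = R \<circ>\<^sub>m L\<close>.
\<close>

definition pm_id :: "'a topology \<Rightarrow> ('a \<rightharpoonup> 'a)" where
  "pm_id X = Some |` topspace X"

text \<open>Only meaningful for \<open>S\<close> injective on its domain.\<close>
definition pm_inv :: "('a \<rightharpoonup> 'a) \<Rightarrow> ('a \<rightharpoonup> 'a)" where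
  "pm_inv S = (\<lambda>x. if x \<in> ran S then Some (THE y. S y = Some x) else None)"

primrec pm_pow :: "'a topology \<Rightarrow> ('a \<rightharpoonup> 'a) \<Rightarrow> nat \<Rightarrow> ('a \<rightharpoonup> 'a)" where
  "pm_pow X S 0 = pm_id X"
| "pm_pow X S (Suc k) = S \<circ>\<^sub>m pm_pow X S k"

definition agree_on :: "'a set \<Rightarrow> ('a \<rightharpoonup> 'a) \<Rightarrow> ('a \<rightharpoonup> 'a) \<Rightarrow> bool" where
  "agree_on U S S' \<longleftrightarrow> U \<subseteq> dom S \<inter> dom S' \<and> (\<forall>x\<in>U. S x = S' x)"

definition open_homeo :: "'a topology \<Rightarrow> ('a \<rightharpoonup> 'a) \<Rightarrow> bool" where
  "open_homeo X S \<longleftrightarrow> openin X (dom S) \<and> openin X (ran S) \<and>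
     homeomorphic_map (subtopology X (dom S)) (subtopology X (ran S)) (the \<circ> S)"

definition open_local_homeo :: "'a topology \<Rightarrow> ('a \<rightharpoonup> 'a) \<Rightarrow> bool" where
  "open_local_homeo X S \<longleftrightarrow> openin X (dom S) \<and> openin X (ran S) \<and>
     (\<forall>x\<in>dom S. \<exists>U. openin X U \<and> x \<in> U \<and> U \<subseteq> dom S \<and> open_homeo X (S |` U))"

text \<open>\<open>U\<close> is an open subset of \<open>dom S\<close> on which \<open>S\<close> is injective.\<close>
definition open_inj :: "'a topology \<Rightarrow> ('a \<rightharpoonup> 'a) \<Rightarrow> 'a set \<Rightarrow> bool" where
  "open_inj X S U \<longleftrightarrow> openin X U \<and> U \<subseteq> dom S \<and> inj_on S U"

section \<open>Multiply generated dynamical systems\<close>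

text \<open>
  The system consists of \<open>T 0, \<dots>, T (r - 1)\<close>; values of \<open>T\<close> at other indices are never used.
  Elements of \<open>\<nat>\<^sup>r\<close> are the functions on \<open>nat\<close> vanishing outside \<open>{..<r}\<close>, and likewise
  for \<open>\<int>\<^sup>r\<close>.
\<close>

definition multi_idx :: "nat \<Rightarrow> (nat \<Rightarrow> nat) set" where
  "multi_idx r = {n. \<forall>j\<ge>r. n j = 0}"

definition idx_diff :: "(nat \<Rightarrow> nat) \<Rightarrow> (nat \<Rightarrow> nat) \<Rightarrow> (nat \<Rightarrow> int)" where
  "idx_diff m n = (\<lambda>j. int (m j) - int (n j))"

definition mgds :: "'a topology \<Rightarrow> nat \<Rightarrow> (nat \<Rightarrow> ('a \<rightharpoonup> 'a)) \<Rightarrow> bool" where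
  "mgds X r T \<longleftrightarrow> (\<forall>j<r. open_local_homeo X (T j)) \<and>
     (\<forall>i<r. \<forall>j<r. T i \<circ>\<^sub>m T j = T j \<circ>\<^sub>m T i)"

text \<open>\<open>T\<^sup>n\<close> is the product of the powers of \<open>T j\<close> to \<open>n j\<close>, with \<open>j = 0\<close> leftmost (applied last).\<close>
definition mpow :: "'a topology \<Rightarrow> nat \<Rightarrow> (nat \<Rightarrow> ('a \<rightharpoonup> 'a)) \<Rightarrow> (nat \<Rightarrow> nat) \<Rightarrow> ('a \<rightharpoonup> 'a)" where
  "mpow X r T n = foldr (\<lambda>j S. pm_pow X (T j) (n j) \<circ>\<^sub>m S) [0..<r] (pm_id X)"

definition domain_condition :: "'a topology \<Rightarrow> nat \<Rightarrow> (nat \<Rightarrow> ('a \<rightharpoonup> 'a)) \<Rightarrow> bool" where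
  "domain_condition X r T \<longleftrightarrow>
     (\<forall>m\<in>multi_idx r. \<forall>n\<in>multi_idx r.
        dom (mpow X r T n) \<inter> dom (mpow X r T m) \<subseteq> dom (mpow X r T (\<lambda>j. max (n j) (m j))))"

definition essentially_free :: "'a topology \<Rightarrow> nat \<Rightarrow> (nat \<Rightarrow> ('a \<rightharpoonup> 'a)) \<Rightarrow> bool" where
  "essentially_free X r T \<longleftrightarrow>
     (\<forall>m\<in>multi_idx r. \<forall>n\<in>multi_idx r. m \<noteq> n \<longrightarrow>
        \<not> (\<exists>U. openin X U \<and> U \<noteq> {} \<and> agree_on U (mpow X r T n) (mpow X r T m)))"

section \<open>Topological groupoids\<close>

text \<open>
  The data of a topological groupoid: arrows, composable pairs, product, inverse, topology.
  The product is only relevant on composable pairs.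
\<close>
record 'g tgroupoid =
  arrows :: "'g set"
  composable :: "('g \<times> 'g) set"
  gmult :: "'g \<Rightarrow> 'g \<Rightarrow> 'g"
  ginv :: "'g \<Rightarrow> 'g"
  gtop :: "'g topology"

definition tgroupoid_hom :: "'g tgroupoid \<Rightarrow> 'h tgroupoid \<Rightarrow> ('g \<Rightarrow> 'h) \<Rightarrow> bool" where
  "tgroupoid_hom G H \<phi> \<longleftrightarrow>
     \<phi> ` arrows G \<subseteq> arrows H \<and>
     (\<forall>(g, h)\<in>composable G.
        (\<phi> g, \<phi> h) \<in> composable H \<and> \<phi> (gmult G g h) = gmult H (\<phi> g) (\<phi> h)) \<and>
     (\<forall>g\<in>arrows G. \<phi> (ginv G g) = ginv H (\<phi> g)) \<and>
     continuous_map (gtop G) (gtop H) \<phi>"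

definition tgroupoid_iso :: "'g tgroupoid \<Rightarrow> 'h tgroupoid \<Rightarrow> ('g \<Rightarrow> 'h) \<Rightarrow> bool" where
  "tgroupoid_iso G H \<phi> \<longleftrightarrow> tgroupoid_hom G H \<phi> \<and>
     (\<exists>\<psi>. tgroupoid_hom H G \<psi> \<and>
        (\<forall>g\<in>arrows G. \<psi> (\<phi> g) = g) \<and> (\<forall>h\<in>arrows H. \<phi> (\<psi> h) = h))"

section \<open>The semidirect product groupoid\<close>

definition sdp_arrows ::
  "'a topology \<Rightarrow> nat \<Rightarrow> (nat \<Rightarrow> ('a \<rightharpoonup> 'a)) \<Rightarrow> ('a \<times> (nat \<Rightarrow> int) \<times> 'a) set" where
  "sdp_arrows X r T = {(x, idx_diff m n, y) | x m n y.
     m \<in> multi_idx r \<and> n \<in> multi_idx r \<and>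
     x \<in> dom (mpow X r T m) \<and> y \<in> dom (mpow X r T n) \<and> mpow X r T m x = mpow X r T n y}"

definition sdp_basic ::
  "'a topology \<Rightarrow> nat \<Rightarrow> (nat \<Rightarrow> ('a \<rightharpoonup> 'a)) \<Rightarrow> 'a set \<Rightarrow> (nat \<Rightarrow> nat) \<Rightarrow> (nat \<Rightarrow> nat) \<Rightarrow> 'a set
     \<Rightarrow> ('a \<times> (nat \<Rightarrow> int) \<times> 'a) set" where
  "sdp_basic X r T U m n V =
     {(x, idx_diff m n, y) | x y. (x, y) \<in> U \<times> V \<and> mpow X r T m x = mpow X r T n y}"

definition sdp_groupoid ::
  "'a topology \<Rightarrow> nat \<Rightarrow> (nat \<Rightarrow> ('a \<rightharpoonup> 'a)) \<Rightarrow> ('a \<times> (nat \<Rightarrow> int) \<times> 'a) tgroupoid" where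
  "sdp_groupoid X r T = \<lparr>
     arrows = sdp_arrows X r T,
     composable = {((x, z, y), (y', z', w)) | x z y y' z' w.
       (x, z, y) \<in> sdp_arrows X r T \<and> (y', z', w) \<in> sdp_arrows X r T \<and> y = y'},
     gmult = (\<lambda>(x, z, y) (y', z', w). (x, \<lambda>j. z j + z' j, w)),
     ginv = (\<lambda>(x, z, y). (y, \<lambda>j. - z j, x)),
     gtop = topology_generated_by {sdp_basic X r T U m n V | U m n V.
       m \<in> multi_idx r \<and> n \<in> multi_idx r \<and>
       open_inj X (mpow X r T m) U \<and> open_inj X (mpow X r T n) V} \<rparr>"

section \<open>Pseudogroups and germs\<close>

definition pseudogroup :: "'a topology \<Rightarrow> ('a \<rightharpoonup> 'a) set \<Rightarrow> bool" where
  "pseudogroup X H \<longleftrightarrow>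
     (\<forall>S\<in>H. open_homeo X S) \<and> pm_id X \<in> H \<and>
     (\<forall>S\<in>H. \<forall>S'\<in>H. S \<circ>\<^sub>m S' \<in> H) \<and> (\<forall>S\<in>H. pm_inv S \<in> H)"

definition full_pseudogroup :: "'a topology \<Rightarrow> ('a \<rightharpoonup> 'a) set \<Rightarrow> bool" where
  "full_pseudogroup X H \<longleftrightarrow> pseudogroup X H \<and>
     (\<forall>S. open_homeo X S \<and>
          (\<forall>x\<in>dom S. \<exists>S'\<in>H. \<exists>U. openin X U \<and> x \<in> U \<and> agree_on U S S') \<longrightarrow> S \<in> H)"

definition generated_full_pseudogroup ::
  "'a topology \<Rightarrow> ('a \<rightharpoonup> 'a) set \<Rightarrow> ('a \<rightharpoonup> 'a) set" where
  "generated_full_pseudogroup X A = \<Inter>{H. full_pseudogroup X H \<and> A \<subseteq> H}"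

definition mgds_pseudogroup ::
  "'a topology \<Rightarrow> nat \<Rightarrow> (nat \<Rightarrow> ('a \<rightharpoonup> 'a)) \<Rightarrow> ('a \<rightharpoonup> 'a) set" where
  "mgds_pseudogroup X r T =
     generated_full_pseudogroup X {T j |` U | j U. j < r \<and> open_inj X (T j) U}"

text \<open>Representatives \<open>(x, S, y)\<close> of germs, with \<open>y \<in> dom S\<close> and \<open>x = S(y)\<close>.\<close>
definition germ_reps ::
  "('a \<rightharpoonup> 'a) set \<Rightarrow> ('a \<times> ('a \<rightharpoonup> 'a) \<times> 'a) set" where
  "germ_reps H = {(x, S, y). S \<in> H \<and> S y = Some x}"

definition germ_rel ::
  "'a topology \<Rightarrow> ('a \<rightharpoonup> 'a) set
     \<Rightarrow> (('a \<times> ('a \<rightharpoonup> 'a) \<times> 'a) \<times> ('a \<times> ('a \<rightharpoonup> 'a) \<times> 'a)) set" where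
  "germ_rel X H = {((x1, S1, y1), (x2, S2, y2)).
     (x1, S1, y1) \<in> germ_reps H \<and> (x2, S2, y2) \<in> germ_reps H \<and>
     y1 = y2 \<and> (\<exists>W. openin X W \<and> y1 \<in> W \<and> agree_on W S1 S2)}"

definition germ ::
  "'a topology \<Rightarrow> ('a \<rightharpoonup> 'a) set \<Rightarrow> 'a \<Rightarrow> ('a \<rightharpoonup> 'a) \<Rightarrow> 'a \<Rightarrow> ('a \<times> ('a \<rightharpoonup> 'a) \<times> 'a) set" where
  "germ X H x S y = germ_rel X H `` {(x, S, y)}"

text \<open>
  The unions in product and inverse run over all representatives; each is a single class,
  because the class obtained does not depend on the representatives.
\<close>
definition germ_groupoid ::
  "'a topology \<Rightarrow> ('a \<rightharpoonup> 'a) set \<Rightarrow> ('a \<times> ('a \<rightharpoonup> 'a) \<times> 'a) set tgroupoid" where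
  "germ_groupoid X H = \<lparr>
     arrows = germ_reps H // germ_rel X H,
     composable = {(germ X H x S y, germ X H y S' z) | x S y S' z.
       (x, S, y) \<in> germ_reps H \<and> (y, S', z) \<in> germ_reps H},
     gmult = (\<lambda>g h. \<Union>(x, S, y)\<in>g. \<Union>(y', S', z)\<in>h. germ X H x (S \<circ>\<^sub>m S') z),
     ginv = (\<lambda>g. \<Union>(x, S, y)\<in>g. germ X H y (pm_inv S) x),
     gtop = topology_generated_by
       {{germ X H (the (S y)) S y | y. y \<in> W} | S W. S \<in> H \<and> openin X W \<and> W \<subseteq> dom S} \<rparr>"

abbreviation mgds_germ_groupoid ::
  "'a topology \<Rightarrow> nat \<Rightarrow> (nat \<Rightarrow> ('a \<rightharpoonup> 'a)) \<Rightarrow> ('a \<times> ('a \<rightharpoonup> 'a) \<times> 'a) set tgroupoid" where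
  "mgds_germ_groupoid X r T \<equiv> germ_groupoid X (mgds_pseudogroup X r T)"

section \<open>The canonical homomorphism\<close>

text \<open>
  The value at \<open>(x, z, y)\<close> is the class obtained from any \<open>m, n\<close> with \<open>z = m - n\<close>,
  \<open>T\<^sup>m x = T\<^sup>n y\<close> and any admissible \<open>U, V\<close>; it is uniquely determined on the arrows of the
  semidirect product groupoid if the domain condition holds.
\<close>
definition germ_map ::
  "'a topology \<Rightarrow> nat \<Rightarrow> (nat \<Rightarrow> ('a \<rightharpoonup> 'a)) \<Rightarrow> 'a \<times> (nat \<Rightarrow> int) \<times> 'a
     \<Rightarrow> ('a \<times> ('a \<rightharpoonup> 'a) \<times> 'a) set" where
  "germ_map X r T = (\<lambda>(x, z, y). THE g. \<exists>m\<in>multi_idx r. \<exists>n\<in>multi_idx r. \<exists>U V.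
     z = idx_diff m n \<and> mpow X r T m x = mpow X r T n y \<and>
     x \<in> U \<and> open_inj X (mpow X r T m) U \<and> y \<in> V \<and> open_inj X (mpow X r T n) V \<and>
     g = germ X (mgds_pseudogroup X r T) x
           (pm_inv (mpow X r T m |` U) \<circ>\<^sub>m (mpow X r T n |` V)) y)"

end

theory Submission
  imports Defs
begin

text \<open>
  A germ \<open>[x, S, y]\<close> is the image of \<open>(x, m - n, y)\<close> exactly when \<open>T\<^sup>m S = T\<^sup>n\<close> near \<open>y\<close>. Given two
  such relations \<open>T\<^sup>m S = T\<^sup>n\<close> and \<open>T\<^sup>m\<^sup>' S' = T\<^sup>n\<^sup>'\<close> at the same \<open>y\<close> with \<open>S y = S' y\<close>, the domain
  condition allows both to be raised to the common left exponent \<open>p = m \<or> m'\<close>: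
  \<open>T\<^sup>p S = T\<^sup>a\<close> and \<open>T\<^sup>p S' = T\<^sup>b\<close> with \<open>a = p - m + n\<close>, \<open>b = p - m' + n'\<close>. If \<open>m - n = m' - n'\<close>
  then \<open>a = b\<close>, and local injectivity of \<open>T\<^sup>p\<close> gives equality of the germs, so \<open>\<pi>\<close> is well defined.
  If conversely the germs agree, then \<open>T\<^sup>a = T\<^sup>b\<close> near \<open>y\<close>, so essential freeness forces \<open>a = b\<close>,
  i.e. \<open>m - n = m' - n'\<close>, and \<open>\<pi>\<close> is injective. Without essential freeness, some
  \<open>(x, m - n, x)\<close> with \<open>m \<noteq> n\<close> is mapped to a unit.
\<close>

section \<open>Partial maps\<close>

lemma map_comp_assoc: "(f \<circ>\<^sub>m g) \<circ>\<^sub>m h = f \<circ>\<^sub>m (g \<circ>\<^sub>m h)"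
  by (auto simp: map_comp_def split: option.splits)

lemma pm_id_apply: "pm_id X x = (if x \<in> topspace X then Some x else None)"
  by (simp add: pm_id_def restrict_map_def)

lemma dom_pm_id [simp]: "dom (pm_id X) = topspace X"
  by (auto simp: pm_id_apply split: if_splits)

lemma restrict_map_eq_Some_iff: "(S |` U) x = Some y \<longleftrightarrow> x \<in> U \<and> S x = Some y"
  by (simp add: restrict_map_def)

lemma map_comp_pm_id:
  assumes "dom S \<subseteq> topspace X"
  shows "S \<circ>\<^sub>m pm_id X = S"
proof
  fix x
  have "S x = None" if "x \<notin> topspace X"
    using that assms by (metis domIff subsetD)
  then show "(S \<circ>\<^sub>m pm_id X) x = S x"
    by (simp add: map_comp_def pm_id_apply)
qed

lemma pm_id_map_comp: "ran S \<subseteq> topspace X \<Longrightarrow> pm_id X \<circ>\<^sub>m S = S"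
  by (rule ext) (auto simp: map_comp_def pm_id_apply ran_def split: option.splits)

lemma inj_on_domD: "inj_on S (dom S) \<Longrightarrow> S x = Some z \<Longrightarrow> S y = Some z \<Longrightarrow> x = y"
  by (metis domI inj_onD)

lemma inj_on_dom_iff:
  "inj_on S (dom S) \<longleftrightarrow> (\<forall>x y z. S x = Some z \<longrightarrow> S y = Some z \<longrightarrow> x = y)"
  by (auto intro: inj_onI dest: inj_on_domD)

lemma pm_inv_eq_Some_iff:
  assumes "inj_on S (dom S)"
  shows "pm_inv S x = Some y \<longleftrightarrow> S y = Some x"
proof -
  have "(THE y. S y = Some x) = y" if "S y = Some x" for y
    using that assms by (auto intro: the_equality dest: inj_on_domD)
  then show ?thesis
    by (auto simp: pm_inv_def ran_def)
qed

section \<open>Open homeomorphisms described by images and preimages\<close>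

definition pm_image :: "('a \<rightharpoonup> 'a) \<Rightarrow> 'a set \<Rightarrow> 'a set" where
  "pm_image S W = {y. \<exists>x\<in>W. S x = Some y}"

definition pm_vimage :: "('a \<rightharpoonup> 'a) \<Rightarrow> 'a set \<Rightarrow> 'a set" where
  "pm_vimage S W = {x. \<exists>y\<in>W. S x = Some y}"

definition pm_continuous :: "'a topology \<Rightarrow> ('a \<rightharpoonup> 'a) \<Rightarrow> bool" where
  "pm_continuous X S \<longleftrightarrow> (\<forall>W. openin X W \<longrightarrow> openin X (pm_vimage S W))"

text \<open>
  Stated through images and preimages, being an \<open>open_homeo\<close> is visibly stable under composition,
  inversion and gluing, without reference to subspace topologies.
\<close>

lemma open_homeo_iff:
  "open_homeo X S \<longleftrightarrow> dom S \<subseteq> topspace X \<and> ran S \<subseteq> topspace X \<and> inj_on S (dom S) \<and>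
     (\<forall>W. openin X W \<longrightarrow> openin X (pm_image S W)) \<and> pm_continuous X S"
  (is "?L \<longleftrightarrow> ?R")
proof
  assume L: ?L
  then have o: "openin X (dom S)" "openin X (ran S)"
    and h: "homeomorphic_map (subtopology X (dom S)) (subtopology X (ran S)) (the \<circ> S)"
    by (auto simp: open_homeo_def)
  have sub: "dom S \<subseteq> topspace X" "ran S \<subseteq> topspace X"
    using o openin_subset by auto
  then have top: "topspace (subtopology X (dom S)) = dom S"
    by auto
  have inj: "inj_on (the \<circ> S) (dom S)"
    using homeomorphic_imp_injective_map[OF h] top by simp
  have "inj_on S (dom S)"
    using inj by (auto simp: inj_on_def)
  moreover have "openin X (pm_image S W)" if "openin X W" for W
  proof -
    have "openin (subtopology X (dom S)) (dom S \<inter> W)"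
      using that by (simp add: openin_subtopology_Int2)
    then have "openin (subtopology X (ran S)) ((the \<circ> S) ` (dom S \<inter> W))"
      using homeomorphic_imp_open_map[OF h] by (simp add: open_map_def)
    moreover have "(the \<circ> S) ` (dom S \<inter> W) = pm_image S W"
      by (force simp: pm_image_def image_iff)
    ultimately show ?thesis
      using o(2) openin_open_subtopology by metis
  qed
  moreover have "openin X (pm_vimage S W)" if "openin X W" for W
  proof -
    have "openin (subtopology X (ran S)) (ran S \<inter> W)"
      using that by (simp add: openin_subtopology_Int2)
    then have "openin (subtopology X (dom S))
        {x \<in> topspace (subtopology X (dom S)). (the \<circ> S) x \<in> ran S \<inter> W}"
      using homeomorphic_imp_continuous_map[OF h] openin_continuous_map_preimage by blast
    moreover have "{x \<in> topspace (subtopology X (dom S)). (the \<circ> S) x \<in> ran S \<inter> W} = pm_vimage S W"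
      unfolding top by (auto simp: pm_vimage_def ran_def)
    ultimately show ?thesis
      using o(1) openin_open_subtopology by metis
  qed
  ultimately show ?R
    using sub by (simp add: pm_continuous_def)
next
  assume R: ?R
  have "dom S = pm_vimage S (topspace X)" "ran S = pm_image S (topspace X)"
    using R by (auto simp: pm_vimage_def pm_image_def ran_def dom_def)
  then have o: "openin X (dom S)" "openin X (ran S)"
    using R by (auto simp: pm_continuous_def)
  have top: "topspace (subtopology X (dom S)) = dom S" "topspace (subtopology X (ran S)) = ran S"
    using R by auto
  have "homeomorphic_map (subtopology X (dom S)) (subtopology X (ran S)) (the \<circ> S)"
  proof (rule bijective_open_imp_homeomorphic_map)
    show "continuous_map (subtopology X (dom S)) (subtopology X (ran S)) (the \<circ> S)"
    proof (unfold continuous_map_def, intro conjI allI impI)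
      show "the \<circ> S \<in> topspace (subtopology X (dom S)) \<rightarrow> topspace (subtopology X (ran S))"
        unfolding top by (auto simp: ran_def)
      fix W assume "openin (subtopology X (ran S)) W"
      then have W: "openin X W"
        using o(2) openin_open_subtopology by blast
      have "{x \<in> topspace (subtopology X (dom S)). (the \<circ> S) x \<in> W} = pm_vimage S W"
        unfolding top by (auto simp: pm_vimage_def)
      then show "openin (subtopology X (dom S)) {x \<in> topspace (subtopology X (dom S)). (the \<circ> S) x \<in> W}"
        using R W o(1) by (auto simp: openin_open_subtopology pm_continuous_def pm_vimage_def)
    qed
    show "open_map (subtopology X (dom S)) (subtopology X (ran S)) (the \<circ> S)"
    proof (unfold open_map_def, intro allI impI)
      fix W assume "openin (subtopology X (dom S)) W"
      then have W: "openin X W" "W \<subseteq> dom S"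
        using o(1) by (auto simp: openin_open_subtopology)
      then have "(the \<circ> S) ` W = pm_image S W"
        by (force simp: pm_image_def image_iff)
      then show "openin (subtopology X (ran S)) ((the \<circ> S) ` W)"
        using R W o(2) by (auto simp: openin_open_subtopology pm_image_def ran_def)
    qed
    show "(the \<circ> S) ` topspace (subtopology X (dom S)) = topspace (subtopology X (ran S))"
      unfolding top by (force simp: ran_def image_iff)
    show "inj_on (the \<circ> S) (topspace (subtopology X (dom S)))"
      unfolding top using R by (auto intro!: inj_onI dest: inj_on_domD)
  qed
  then show ?L
    using o by (simp add: open_homeo_def)
qed

lemma
  assumes "open_homeo X S"
  shows open_homeo_dom: "openin X (dom S)"
    and open_homeo_inj: "inj_on S (dom S)"
    and open_homeo_image: "openin X W \<Longrightarrow> openin X (pm_image S W)"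
    and open_homeo_continuous: "pm_continuous X S"
  using assms open_homeo_iff[of X S] by (auto simp: open_homeo_def)

lemma open_homeo_pm_id: "open_homeo X (pm_id X)"
proof -
  have "pm_image (pm_id X) W = W" "pm_vimage (pm_id X) W = W" if "openin X W" for W
    using openin_subset[OF that]
    by (auto simp: pm_image_def pm_vimage_def pm_id_apply)
  then show ?thesis
    by (auto simp: open_homeo_iff pm_continuous_def pm_id_apply ran_def inj_on_def split: if_splits)
qed

lemma open_homeo_comp:
  assumes "open_homeo X S" "open_homeo X S'"
  shows "open_homeo X (S \<circ>\<^sub>m S')"
proof -
  have *: "pm_image (S \<circ>\<^sub>m S') W = pm_image S (pm_image S' W)"
    "pm_vimage (S \<circ>\<^sub>m S') W = pm_vimage S' (pm_vimage S W)" for W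
    by (auto simp: pm_image_def pm_vimage_def map_comp_Some_iff)
  have "inj_on (S \<circ>\<^sub>m S') (dom (S \<circ>\<^sub>m S'))"
    using assms unfolding open_homeo_iff inj_on_dom_iff map_comp_Some_iff by metis
  moreover have "dom (S \<circ>\<^sub>m S') \<subseteq> dom S'" "ran (S \<circ>\<^sub>m S') \<subseteq> ran S"
    by (auto simp: map_comp_Some_iff ran_def dom_def)
  ultimately show ?thesis
    using assms unfolding open_homeo_iff pm_continuous_def * by (meson subset_trans)
qed

lemma open_homeo_pm_inv:
  assumes "open_homeo X S"
  shows "open_homeo X (pm_inv S)"
proof -
  note inv = pm_inv_eq_Some_iff[OF open_homeo_inj[OF assms]]
  have *: "pm_image (pm_inv S) W = pm_vimage S W" "pm_vimage (pm_inv S) W = pm_image S W" for W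
    by (auto simp: pm_image_def pm_vimage_def inv)
  have "inj_on (pm_inv S) (dom (pm_inv S))"
    unfolding inj_on_dom_iff inv by auto
  moreover have "dom (pm_inv S) = ran S" "ran (pm_inv S) = dom S"
    by (auto simp: dom_def ran_def inv)
  ultimately show ?thesis
    using assms unfolding open_homeo_iff pm_continuous_def * by simp
qed

section \<open>Agreement of partial maps near a point\<close>

text \<open>Equality of germs at \<open>x\<close>, but for arbitrary partial maps: it has to apply
  to products such as \<open>P m \<circ>\<^sub>m S\<close>, which are in general not injective and
  so lie outside the pseudogroup.\<close>

definition agree_near :: "'a topology \<Rightarrow> 'a \<Rightarrow> ('a \<rightharpoonup> 'a) \<Rightarrow> ('a \<rightharpoonup> 'a) \<Rightarrow> bool" where
  "agree_near X x S S' \<longleftrightarrow> (\<exists>W. openin X W \<and> x \<in> W \<and> agree_on W S S')"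

lemma agree_near_refl: "openin X (dom S) \<Longrightarrow> x \<in> dom S \<Longrightarrow> agree_near X x S S"
  unfolding agree_near_def agree_on_def by blast

lemma agree_near_sym: "agree_near X x S S' \<Longrightarrow> agree_near X x S' S"
  unfolding agree_near_def agree_on_def by (metis Int_commute)

lemma agree_near_trans [trans]:
  assumes "agree_near X x S S'" "agree_near X x S' S''"
  shows "agree_near X x S S''"
proof -
  obtain V W where "openin X V" "x \<in> V" "agree_on V S S'" "openin X W" "x \<in> W" "agree_on W S' S''"
    using assms by (auto simp: agree_near_def)
  then have "openin X (V \<inter> W)" "x \<in> V \<inter> W" "agree_on (V \<inter> W) S S''"
    by (auto simp: agree_on_def)
  then show ?thesis
    unfolding agree_near_def by blast
qed

lemma agree_nearD: "agree_near X x S S' \<Longrightarrow> S x = S' x \<and> x \<in> dom S \<and> x \<in> dom S'"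
  by (auto simp: agree_near_def agree_on_def)

text \<open>Continuity of the inner map \<open>f\<close> pulls a neighbourhood of \<open>x\<close>
  on which the outer maps agree back to a neighbourhood of \<open>y\<close>.\<close>

lemma agree_near_comp:
  assumes "agree_near X y f f'" "f y = Some x" "pm_continuous X f" "agree_near X x g g'"
  shows "agree_near X y (g \<circ>\<^sub>m f) (g' \<circ>\<^sub>m f')"
proof -
  obtain V W where V: "openin X V" "y \<in> V" "agree_on V f f'"
    and W: "openin X W" "x \<in> W" "agree_on W g g'"
    using assms by (auto simp: agree_near_def)
  let ?U = "V \<inter> pm_vimage f W"
  have "openin X ?U" "y \<in> ?U"
    using V W assms by (auto simp: pm_continuous_def pm_vimage_def)
  moreover have "agree_on ?U (g \<circ>\<^sub>m f) (g' \<circ>\<^sub>m f')"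
    unfolding agree_on_def
  proof (intro conjI ballI subsetI)
    fix w assume w: "w \<in> ?U"
    then obtain v where v: "v \<in> W" "f w = Some v" "w \<in> V"
      by (auto simp: pm_vimage_def)
    moreover have "f' w = Some v"
      using V(3) v by (metis agree_on_def)
    moreover obtain u where "g v = Some u" "g' v = Some u"
      using W(3) v(1) unfolding agree_on_def by (metis IntD1 domD subsetD)
    ultimately show "w \<in> dom (g \<circ>\<^sub>m f) \<inter> dom (g' \<circ>\<^sub>m f')" "(g \<circ>\<^sub>m f) w = (g' \<circ>\<^sub>m f') w"
      by auto
  qed
  ultimately show ?thesis
    unfolding agree_near_def by blast
qed

lemma agree_near_restrict:
  assumes "openin X U" "x \<in> U" "x \<in> dom S" "openin X (dom S)"
  shows "agree_near X x (S |` U) S"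
  unfolding agree_near_def
  by (rule exI[of _ "U \<inter> dom S"]) (use assms in \<open>auto simp: agree_on_def\<close>)

text \<open>Openness of images and of preimages can be tested near each point, so it is inherited
  from the local models. Injectivity is a global property and is therefore assumed for
  \<open>S\<close> itself.\<close>

lemma open_homeo_local:
  assumes inj: "inj_on S (dom S)"
    and loc: "\<And>x. x \<in> dom S \<Longrightarrow> \<exists>S'. open_homeo X S' \<and> agree_near X x S S'"
  shows "open_homeo X S"
proof -
  have loc': "\<exists>S' U. open_homeo X S' \<and> openin X U \<and> x \<in> U \<and> U \<subseteq> dom S \<and> (\<forall>u\<in>U. S u = S' u)"
    if "x \<in> dom S" for x
    using loc[OF that] unfolding agree_near_def agree_on_def by blast
  have "dom S \<subseteq> topspace X"
    using loc' openin_subset by blast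
  moreover have "ran S \<subseteq> topspace X"
  proof
    fix y assume "y \<in> ran S"
    then obtain x where x: "S x = Some y"
      by (auto simp: ran_def)
    then obtain S' U where "open_homeo X S'" "x \<in> U" "\<forall>u\<in>U. S u = S' u"
      using loc' by blast
    then show "y \<in> topspace X"
      using x by (metis open_homeo_iff ranI subsetD)
  qed
  moreover have "openin X (pm_image S W)" if W: "openin X W" for W
  proof (subst openin_subopen, intro ballI)
    fix y assume "y \<in> pm_image S W"
    then obtain x where x: "S x = Some y" "x \<in> W"
      by (auto simp: pm_image_def)
    then obtain S' U where U: "open_homeo X S'" "openin X U" "x \<in> U" "\<forall>u\<in>U. S u = S' u"
      using loc' by blast
    have "openin X (pm_image S' (W \<inter> U))"
      using U W open_homeo_image by blast
    moreover have "y \<in> pm_image S' (W \<inter> U)" "pm_image S' (W \<inter> U) \<subseteq> pm_image S W"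
      using x U unfolding pm_image_def by fastforce+
    ultimately show "\<exists>V. openin X V \<and> y \<in> V \<and> V \<subseteq> pm_image S W"
      by blast
  qed
  moreover have "openin X (pm_vimage S W)" if W: "openin X W" for W
  proof (subst openin_subopen, intro ballI)
    fix x assume "x \<in> pm_vimage S W"
    then obtain y where x: "S x = Some y" "y \<in> W"
      by (auto simp: pm_vimage_def)
    then obtain S' U where U: "open_homeo X S'" "openin X U" "x \<in> U" "\<forall>u\<in>U. S u = S' u"
      using loc' by blast
    have "openin X (U \<inter> pm_vimage S' W)"
      using U W open_homeo_continuous unfolding pm_continuous_def by blast
    moreover have "x \<in> U \<inter> pm_vimage S' W" "U \<inter> pm_vimage S' W \<subseteq> pm_vimage S W"
      using x U by (auto simp: pm_vimage_def)
    ultimately show "\<exists>V. openin X V \<and> x \<in> V \<and> V \<subseteq> pm_vimage S W"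
      by blast
  qed
  ultimately show ?thesis
    using inj by (simp add: open_homeo_iff pm_continuous_def)
qed

section \<open>Pseudogroups and germs\<close>

lemma full_pseudogroup_altdef:
  "full_pseudogroup X H \<longleftrightarrow> pseudogroup X H \<and>
     (\<forall>S. open_homeo X S \<and> (\<forall>x\<in>dom S. \<exists>S'\<in>H. agree_near X x S S') \<longrightarrow> S \<in> H)"
  by (simp add: full_pseudogroup_def agree_near_def)

text \<open>All closure conditions pass to intersections. That the members are homeomorphisms needs
  one competitor consisting of homeomorphisms only: the set of all open homeomorphisms, which
  contains \<open>A\<close> by assumption.\<close>

lemma full_pseudogroup_generated:
  assumes "\<And>S. S \<in> A \<Longrightarrow> open_homeo X S"
  shows "full_pseudogroup X (generated_full_pseudogroup X A)"
proof -
  let ?F = "{H. full_pseudogroup X H \<and> A \<subseteq> H}"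
  have "full_pseudogroup X {S. open_homeo X S}"
    by (simp add: full_pseudogroup_def pseudogroup_def open_homeo_pm_id open_homeo_comp
        open_homeo_pm_inv)
  then have mem: "{S. open_homeo X S} \<in> ?F"
    using assms by auto
  have F: "pseudogroup X H" if "H \<in> ?F" for H
    using that by (simp add: full_pseudogroup_def)
  have "pseudogroup X (\<Inter>?F)"
    unfolding pseudogroup_def
  proof (intro conjI ballI InterI)
    fix S assume "S \<in> \<Inter>?F"
    then show "open_homeo X S"
      using mem by blast
  next
    fix H assume "H \<in> ?F"
    then show "pm_id X \<in> H"
      using F by (metis pseudogroup_def)
  next
    fix S S' H assume S: "S \<in> \<Inter>?F" "S' \<in> \<Inter>?F" and H: "H \<in> ?F"
    have "S \<in> H" "S' \<in> H"
      using InterD[OF S(1) H] InterD[OF S(2) H] .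
    then show "S \<circ>\<^sub>m S' \<in> H"
      using F[OF H] by (simp add: pseudogroup_def)
  next
    fix S H assume S: "S \<in> \<Inter>?F" and H: "H \<in> ?F"
    have "S \<in> H"
      using S H by (rule InterD)
    then show "pm_inv S \<in> H"
      using F[OF H] by (simp add: pseudogroup_def)
  qed
  moreover have "S \<in> H"
    if "open_homeo X S" "\<forall>x\<in>dom S. \<exists>S'\<in>\<Inter>?F. agree_near X x S S'" "H \<in> ?F" for S H
  proof -
    have "\<forall>x\<in>dom S. \<exists>S'\<in>H. agree_near X x S S'"
      using that(2,3) by blast
    then show ?thesis
      using that(1,3) by (auto simp: full_pseudogroup_altdef)
  qed
  ultimately show ?thesis
    unfolding generated_full_pseudogroup_def full_pseudogroup_altdef by blast
qed

section \<open>Germs as equivalence classes and their groupoid operations\<close>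

lemma germ_rel_iff:
  "((x, S, y), (x', S', y')) \<in> germ_rel X H \<longleftrightarrow>
     (x, S, y) \<in> germ_reps H \<and> (x', S', y') \<in> germ_reps H \<and> y = y' \<and> agree_near X y S S'"
  by (auto simp: germ_rel_def agree_near_def)

lemma equiv_germ_rel:
  assumes "pseudogroup X H"
  shows "equiv (germ_reps H) (germ_rel X H)"
proof (rule equivI)
  show "germ_rel X H \<subseteq> germ_reps H \<times> germ_reps H"
    by (auto simp: germ_rel_def)
  show "refl_on (germ_reps H) (germ_rel X H)"
  proof (rule refl_onI)
    fix g assume g: "g \<in> germ_reps H"
    obtain x S y where [simp]: "g = (x, S, y)"
      by (cases g)
    have "S \<in> H" "y \<in> dom S"
      using g by (auto simp: germ_reps_def)
    then have "agree_near X y S S"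
      using assms by (intro agree_near_refl) (auto simp: pseudogroup_def open_homeo_dom)
    then show "(g, g) \<in> germ_rel X H"
      using g by (simp add: germ_rel_iff)
  qed
  show "sym (germ_rel X H)"
    by (rule symI) (auto simp: germ_rel_iff intro: agree_near_sym)
  show "trans (germ_rel X H)"
    by (rule transI) (auto simp: germ_rel_iff intro: agree_near_trans)
qed

text \<open>Equal classes are related triples. The equation \<open>x = x'\<close> is part of this,
  because maps that agree near \<open>y\<close> have the same value at \<open>y\<close>.\<close>

lemma germ_eq_iff:
  assumes "pseudogroup X H" "(x, S, y) \<in> germ_reps H" "(x', S', y') \<in> germ_reps H"
  shows "germ X H x S y = germ X H x' S' y' \<longleftrightarrow> x = x' \<and> y = y' \<and> agree_near X y S S'"
proof -
  have "germ X H x S y = germ X H x' S' y' \<longleftrightarrow> ((x, S, y), (x', S', y')) \<in> germ_rel X H"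
    unfolding germ_def using eq_equiv_class_iff[OF equiv_germ_rel] assms by metis
  also have "\<dots> \<longleftrightarrow> x = x' \<and> y = y' \<and> agree_near X y S S'"
    using assms(2,3) by (auto simp: germ_rel_iff germ_reps_def dest: agree_nearD)
  finally show ?thesis .
qed

lemma mem_germ_iff:
  assumes "(x, S, y) \<in> germ_reps H"
  shows "g \<in> germ X H x S y \<longleftrightarrow> (\<exists>S'. g = (x, S', y) \<and> (x, S', y) \<in> germ_reps H \<and> agree_near X y S S')"
  using assms by (cases g) (auto simp: germ_def germ_rel_iff germ_reps_def dest: agree_nearD)

lemma germ_self:
  assumes "pseudogroup X H" "(x, S, y) \<in> germ_reps H"
  shows "(x, S, y) \<in> germ X H x S y"
  unfolding germ_def using equiv_class_self[OF equiv_germ_rel] assms by metis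

lemma germ_reps_comp:
  assumes "pseudogroup X H" "(x, S, y) \<in> germ_reps H" "(y, S', z) \<in> germ_reps H"
  shows "(x, S \<circ>\<^sub>m S', z) \<in> germ_reps H"
  using assms by (auto simp: germ_reps_def pseudogroup_def)

lemma germ_reps_inv:
  assumes "pseudogroup X H" "(x, S, y) \<in> germ_reps H"
  shows "(y, pm_inv S, x) \<in> germ_reps H"
  using assms by (auto simp: germ_reps_def pseudogroup_def pm_inv_eq_Some_iff open_homeo_inj)

text \<open>By \<open>agree_near_comp\<close> every pair of representatives contributes the same
  class to the double union, and \<open>germ_self\<close> shows that neither index set is empty, so
  the union is that single class.\<close>

lemma gmult_germ:
  assumes H: "pseudogroup X H" and g: "(x, S, y) \<in> germ_reps H" and h: "(y, S', z) \<in> germ_reps H"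
  shows "gmult (germ_groupoid X H) (germ X H x S y) (germ X H y S' z) = germ X H x (S \<circ>\<^sub>m S') z"
proof -
  have eq: "germ X H x (R \<circ>\<^sub>m R') z = germ X H x (S \<circ>\<^sub>m S') z"
    if R: "(x, R, y) \<in> germ_reps H" "agree_near X y S R"
      "(y, R', z) \<in> germ_reps H" "agree_near X z S' R'" for R R'
  proof -
    have "agree_near X z (S \<circ>\<^sub>m S') (R \<circ>\<^sub>m R')"
      using that h H by (intro agree_near_comp[where x = y])
        (auto simp: germ_reps_def pseudogroup_def open_homeo_continuous)
    then show ?thesis
      using germ_eq_iff[OF H germ_reps_comp[OF H g h] germ_reps_comp[OF H R(1,3)]] by simp
  qed
  have "(\<Union>(x', R, y')\<in>germ X H x S y. \<Union>(y'', R', z')\<in>germ X H y S' z. germ X H x' (R \<circ>\<^sub>m R') z')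
    = germ X H x (S \<circ>\<^sub>m S') z"
  proof (rule SUP_eq_const)
    fix g' assume "g' \<in> germ X H x S y"
    then obtain R where R: "g' = (x, R, y)" "(x, R, y) \<in> germ_reps H" "agree_near X y S R"
      using mem_germ_iff[OF g] by blast
    have "(\<Union>(y'', R', z')\<in>germ X H y S' z. germ X H x (R \<circ>\<^sub>m R') z') = germ X H x (S \<circ>\<^sub>m S') z"
    proof (rule SUP_eq_const)
      fix h' assume "h' \<in> germ X H y S' z"
      then obtain R' where "h' = (y, R', z)" "(y, R', z) \<in> germ_reps H" "agree_near X z S' R'"
        using mem_germ_iff[OF h] by blast
      then show "(case h' of (y'', R', z') \<Rightarrow> germ X H x (R \<circ>\<^sub>m R') z') = germ X H x (S \<circ>\<^sub>m S') z"
        using eq R by simp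
    qed (use germ_self[OF H h] in blast)
    then show "(case g' of (x', R, y') \<Rightarrow> \<Union>(y'', R', z')\<in>germ X H y S' z. germ X H x' (R \<circ>\<^sub>m R') z')
        = germ X H x (S \<circ>\<^sub>m S') z"
      by (simp add: R(1))
  qed (use germ_self[OF H g] in blast)
  then show ?thesis
    by (simp add: germ_groupoid_def)
qed

text \<open>If the maps agree on \<open>W\<close>, their inverses agree on the image of
  \<open>W\<close>, which is open because \<open>S\<close> is an open map.\<close>

lemma agree_near_pm_inv:
  assumes "open_homeo X S" "open_homeo X S'" "agree_near X y S S'" "S y = Some x"
  shows "agree_near X x (pm_inv S) (pm_inv S')"
proof -
  obtain W where W: "openin X W" "y \<in> W" "agree_on W S S'"
    using assms by (auto simp: agree_near_def)
  have "agree_on (pm_image S W) (pm_inv S) (pm_inv S')"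
    unfolding agree_on_def
  proof (intro conjI ballI subsetI)
    fix v assume "v \<in> pm_image S W"
    then obtain w where w: "w \<in> W" "S w = Some v"
      by (auto simp: pm_image_def)
    then have "S' w = Some v"
      using W by (metis agree_on_def)
    then have "pm_inv S v = Some w" "pm_inv S' v = Some w"
      using assms w by (simp_all add: pm_inv_eq_Some_iff open_homeo_inj)
    then show "v \<in> dom (pm_inv S) \<inter> dom (pm_inv S')" "pm_inv S v = pm_inv S' v"
      by auto
  qed
  moreover have "openin X (pm_image S W)" "x \<in> pm_image S W"
    using W(2) assms(4) by (auto simp: open_homeo_image[OF assms(1) W(1)]) (auto simp: pm_image_def)
  ultimately show ?thesis
    unfolding agree_near_def by blast
qed

lemma ginv_germ:
  assumes H: "pseudogroup X H" and g: "(x, S, y) \<in> germ_reps H"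
  shows "ginv (germ_groupoid X H) (germ X H x S y) = germ X H y (pm_inv S) x"
proof -
  have eq: "germ X H y (pm_inv R) x = germ X H y (pm_inv S) x"
    if R: "(x, R, y) \<in> germ_reps H" "agree_near X y S R" for R
  proof -
    have "agree_near X x (pm_inv S) (pm_inv R)"
      using that g H by (intro agree_near_pm_inv[where y = y]) (auto simp: germ_reps_def pseudogroup_def)
    then show ?thesis
      using germ_eq_iff[OF H germ_reps_inv[OF H g] germ_reps_inv[OF H R(1)]] by simp
  qed
  have "(\<Union>(x', R, y')\<in>germ X H x S y. germ X H y' (pm_inv R) x') = germ X H y (pm_inv S) x"
  proof (rule SUP_eq_const)
    fix g' assume "g' \<in> germ X H x S y"
    then obtain R where "g' = (x, R, y)" "(x, R, y) \<in> germ_reps H" "agree_near X y S R"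
      using mem_germ_iff[OF g] by blast
    then show "(case g' of (x', R, y') \<Rightarrow> germ X H y' (pm_inv R) x') = germ X H y (pm_inv S) x"
      using eq by simp
  qed (use germ_self[OF H g] in blast)
  then show ?thesis
    by (simp add: germ_groupoid_def)
qed

lemma germ_in_arrows: "(x, S, y) \<in> germ_reps H \<Longrightarrow> germ X H x S y \<in> arrows (germ_groupoid X H)"
  by (simp add: germ_groupoid_def germ_def quotientI)

lemma germ_composableI:
  assumes "(x, S, y) \<in> germ_reps H" "(y, S', z) \<in> germ_reps H"
  shows "(germ X H x S y, germ X H y S' z) \<in> composable (germ_groupoid X H)"
  using assms by (simp add: germ_groupoid_def) blast

lemma arrows_germ_groupoidE:
  assumes "g \<in> arrows (germ_groupoid X H)"
  obtains x S y where "g = germ X H x S y" "(x, S, y) \<in> germ_reps H"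
  using assms by (auto simp: germ_groupoid_def germ_def quotient_def)

section \<open>Partial maps that belong to a pseudogroup locally\<close>

text \<open>Captures the powers of the system: near each point of its domain such a power restricts
  to an element of the pseudogroup, although it is in general not injective and hence no element
  itself.\<close>

definition locally_in :: "'a topology \<Rightarrow> ('a \<rightharpoonup> 'a) set \<Rightarrow> ('a \<rightharpoonup> 'a) \<Rightarrow> bool" where
  "locally_in X H S \<longleftrightarrow> (\<forall>x\<in>dom S. \<exists>U. openin X U \<and> x \<in> U \<and> U \<subseteq> dom S \<and> S |` U \<in> H)"

lemma locally_in_comp:
  assumes H: "pseudogroup X H" and S: "locally_in X H S" and S': "locally_in X H S'"
  shows "locally_in X H (S \<circ>\<^sub>m S')"
  unfolding locally_in_def
proof
  fix x assume "x \<in> dom (S \<circ>\<^sub>m S')"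
  then obtain y where y: "S' x = Some y" "y \<in> dom S"
    by (auto simp: map_comp_Some_iff dom_def)
  obtain U where U: "openin X U" "y \<in> U" "U \<subseteq> dom S" "S |` U \<in> H"
    using S y(2) unfolding locally_in_def by blast
  obtain U' where U': "openin X U'" "x \<in> U'" "U' \<subseteq> dom S'" "S' |` U' \<in> H"
    using S' y(1) unfolding locally_in_def by blast
  \<comment> \<open>On this preimage the restricted composite equals the composite of the two
    restrictions, and the latter lies in \<open>H\<close>.\<close>
  let ?W = "pm_vimage (S' |` U') U"
  have "pm_continuous X (S' |` U')"
    using H U'(4) by (auto simp: pseudogroup_def intro: open_homeo_continuous)
  then have "openin X ?W"
    using U(1) by (simp add: pm_continuous_def)
  moreover have "x \<in> ?W"
    using U U' y by (simp add: pm_vimage_def restrict_map_eq_Some_iff)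
  moreover have "?W \<subseteq> dom (S \<circ>\<^sub>m S')"
    using U(3) by (auto simp: pm_vimage_def restrict_map_eq_Some_iff map_comp_Some_iff)
  moreover have "(S \<circ>\<^sub>m S') |` ?W = (S |` U) \<circ>\<^sub>m (S' |` U')"
  proof -
    have "((S \<circ>\<^sub>m S') |` ?W) w = Some z \<longleftrightarrow> ((S |` U) \<circ>\<^sub>m (S' |` U')) w = Some z" for w z
      by (auto simp: restrict_map_eq_Some_iff map_comp_Some_iff pm_vimage_def)
    then show ?thesis
      by (metis (no_types, lifting) ext option.exhaust)
  qed
  ultimately show "\<exists>W. openin X W \<and> x \<in> W \<and> W \<subseteq> dom (S \<circ>\<^sub>m S') \<and> (S \<circ>\<^sub>m S') |` W \<in> H"
    using H U(4) U'(4) unfolding pseudogroup_def by metis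
qed

lemma locally_in_dom: "locally_in X H S \<Longrightarrow> openin X (dom S)"
  unfolding locally_in_def by (subst openin_subopen) blast

lemma locally_in_continuous:
  assumes H: "pseudogroup X H" and S: "locally_in X H S"
  shows "pm_continuous X S"
  unfolding pm_continuous_def
proof (intro allI impI)
  fix W assume W: "openin X W"
  show "openin X (pm_vimage S W)"
  proof (subst openin_subopen, intro ballI)
    fix x assume x: "x \<in> pm_vimage S W"
    then have "x \<in> dom S"
      by (auto simp: pm_vimage_def)
    then obtain U where U: "openin X U" "x \<in> U" "S |` U \<in> H"
      using S unfolding locally_in_def by blast
    then have "pm_continuous X (S |` U)"
      using H by (auto simp: pseudogroup_def intro: open_homeo_continuous)
    then have "openin X (pm_vimage (S |` U) W)"
      using W by (simp add: pm_continuous_def)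
    moreover have "x \<in> pm_vimage (S |` U) W" "pm_vimage (S |` U) W \<subseteq> pm_vimage S W"
      using x U by (auto simp: pm_vimage_def restrict_map_eq_Some_iff)
    ultimately show "\<exists>V. openin X V \<and> x \<in> V \<and> V \<subseteq> pm_vimage S W"
      by blast
  qed
qed

lemma inj_on_restrict_map_iff:
  assumes "U \<subseteq> dom S"
  shows "inj_on (S |` U) (dom (S |` U)) \<longleftrightarrow> inj_on S U"
  using assms by (auto simp: inj_on_def Int_absorb1)

lemma locally_in_open_inj:
  assumes H: "pseudogroup X H" and S: "locally_in X H S" and x: "x \<in> dom S"
  obtains U where "x \<in> U" "open_inj X S U"
proof -
  obtain U where U: "openin X U" "x \<in> U" "U \<subseteq> dom S" "S |` U \<in> H"
    using S x unfolding locally_in_def by blast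
  then have "open_homeo X (S |` U)"
    using H by (simp add: pseudogroup_def)
  then have "inj_on S U"
    using open_homeo_inj inj_on_restrict_map_iff[OF U(3)] by blast
  then show ?thesis
    using U that by (simp add: open_inj_def)
qed

lemma agree_near_restrict_restrict:
  assumes "openin X U" "openin X V" "x \<in> U" "x \<in> V" "V \<subseteq> dom S"
  shows "agree_near X x (S |` V) (S |` U)"
  unfolding agree_near_def agree_on_def using assms
  by (intro exI[of _ "U \<inter> V"]) (auto simp: restrict_map_def)

text \<open>Kept apart from \<open>locally_in_restrict\<close> because it must also apply to the
  generators, before the set generated by them is known to be a pseudogroup.\<close>

lemma open_homeo_restrict:
  assumes V: "open_inj X S V"
    and loc: "\<And>x. x \<in> V \<Longrightarrow> \<exists>U. openin X U \<and> x \<in> U \<and> open_homeo X (S |` U)"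
  shows "open_homeo X (S |` V)"
proof (rule open_homeo_local)
  have "openin X V" and sub: "V \<subseteq> dom S" and "inj_on S V"
    using V by (auto simp: open_inj_def)
  then show "inj_on (S |` V) (dom (S |` V))"
    using inj_on_restrict_map_iff[OF sub] by simp
  fix x assume "x \<in> dom (S |` V)"
  then have x: "x \<in> V"
    by auto
  then obtain U where "openin X U" "x \<in> U" "open_homeo X (S |` U)"
    using loc by blast
  then show "\<exists>S'. open_homeo X S' \<and> agree_near X x (S |` V) S'"
    using agree_near_restrict_restrict[OF _ \<open>openin X V\<close> _ x sub, of U] by metis
qed

text \<open>Gluing makes the restriction to \<open>V\<close> a homeomorphism, and fullness then puts
  it into \<open>H\<close>. This is why the local inverses in the definition of
  \<open>germ_map\<close> come from elements of the pseudogroup for every admissible choice of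
  neighbourhoods.\<close>

lemma locally_in_restrict:
  assumes H: "full_pseudogroup X H" and S: "locally_in X H S" and V: "open_inj X S V"
  shows "S |` V \<in> H"
proof -
  have oV: "openin X V" and sub: "V \<subseteq> dom S"
    using V by (auto simp: open_inj_def)
  have loc: "\<exists>U. openin X U \<and> x \<in> U \<and> S |` U \<in> H" if "x \<in> V" for x
  proof -
    have "x \<in> dom S"
      using sub that by (rule subsetD)
    then show ?thesis
      using S unfolding locally_in_def by blast
  qed
  have "pseudogroup X H"
    using H by (simp only: full_pseudogroup_def)
  then have homeo: "open_homeo X S'" if "S' \<in> H" for S'
    using that unfolding pseudogroup_def by blast
  have "open_homeo X (S |` V)"
  proof (rule open_homeo_restrict[OF V])
    fix x assume "x \<in> V"
    then obtain U where "openin X U" "x \<in> U" "S |` U \<in> H"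
      using loc by auto
    then show "\<exists>U. openin X U \<and> x \<in> U \<and> open_homeo X (S |` U)"
      using homeo by auto
  qed
  moreover have "\<forall>x\<in>dom (S |` V). \<exists>S'\<in>H. agree_near X x (S |` V) S'"
  proof
    fix x assume "x \<in> dom (S |` V)"
    then have x: "x \<in> V"
      by auto
    then obtain U where "openin X U" "x \<in> U" "S |` U \<in> H"
      using loc by auto
    then show "\<exists>S'\<in>H. agree_near X x (S |` V) S'"
      using agree_near_restrict_restrict[OF _ oV _ x sub, of U] by metis
  qed
  ultimately show ?thesis
    using H unfolding full_pseudogroup_altdef by blast
qed

section \<open>Powers of commuting partial maps\<close>

text \<open>For such maps \<open>pm_id X\<close> is a two-sided unit of composition; outside
  \<open>topspace X\<close> the map \<open>pm_id X\<close> is undefined.\<close>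

definition pm_on :: "'a topology \<Rightarrow> ('a \<rightharpoonup> 'a) \<Rightarrow> bool" where
  "pm_on X S \<longleftrightarrow> dom S \<subseteq> topspace X \<and> ran S \<subseteq> topspace X"

lemma pm_on_comp: "pm_on X S \<Longrightarrow> pm_on X S' \<Longrightarrow> pm_on X (S \<circ>\<^sub>m S')"
  unfolding pm_on_def dom_def ran_def by (auto simp: map_comp_Some_iff)

lemma pm_on_pm_id: "pm_on X (pm_id X)"
  by (auto simp: pm_on_def ran_def pm_id_apply split: if_splits)

lemma
  assumes "pm_on X S"
  shows comp_pm_id: "S \<circ>\<^sub>m pm_id X = S" and pm_id_comp: "pm_id X \<circ>\<^sub>m S = S"
  using assms by (simp_all add: pm_on_def map_comp_pm_id pm_id_map_comp)

lemma pm_on_pow: "pm_on X S \<Longrightarrow> pm_on X (pm_pow X S k)"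
  by (induction k) (simp_all add: pm_on_pm_id pm_on_comp)

lemma pm_pow_add:
  "pm_on X S \<Longrightarrow> pm_pow X S (a + b) = pm_pow X S a \<circ>\<^sub>m pm_pow X S b"
  by (induction a) (simp_all add: pm_id_comp pm_on_pow map_comp_assoc)

lemma pm_pow_commute:
  assumes "pm_on X S" "pm_on X R" "S \<circ>\<^sub>m R = R \<circ>\<^sub>m S"
  shows "pm_pow X S k \<circ>\<^sub>m R = R \<circ>\<^sub>m pm_pow X S k"
proof (induction k)
  case 0
  show ?case
    using assms by (simp add: comp_pm_id pm_id_comp)
next
  case (Suc k)
  have "pm_pow X S (Suc k) \<circ>\<^sub>m R = S \<circ>\<^sub>m (R \<circ>\<^sub>m pm_pow X S k)"
    by (simp add: map_comp_assoc Suc)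
  also have "\<dots> = R \<circ>\<^sub>m pm_pow X S (Suc k)"
    by (simp add: map_comp_assoc[symmetric] assms(3))
  finally show ?case .
qed

context
  fixes X :: "'a topology" and T :: "nat \<Rightarrow> ('a \<rightharpoonup> 'a)"
begin

text \<open>The product in \<open>mpow\<close> with an arbitrary index list in place of
  \<open>[0..<r]\<close>, so that the exponent laws can be proved by induction on the list.\<close>

abbreviation pm_prod :: "nat list \<Rightarrow> (nat \<Rightarrow> nat) \<Rightarrow> ('a \<rightharpoonup> 'a)" where
  "pm_prod js n \<equiv> foldr (\<lambda>j S. pm_pow X (T j) (n j) \<circ>\<^sub>m S) js (pm_id X)"

lemma pm_on_prod: "(\<And>j. j \<in> set js \<Longrightarrow> pm_on X (T j)) \<Longrightarrow> pm_on X (pm_prod js n)"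
  by (induction js) (simp_all add: pm_on_pm_id pm_on_comp pm_on_pow)

lemma pm_prod_commute:
  assumes "pm_on X R" "\<And>j. j \<in> set js \<Longrightarrow> pm_on X (T j)"
    and "\<And>j. j \<in> set js \<Longrightarrow> T j \<circ>\<^sub>m R = R \<circ>\<^sub>m T j"
  shows "pm_prod js n \<circ>\<^sub>m R = R \<circ>\<^sub>m pm_prod js n"
  using assms(2,3)
proof (induction js)
  case Nil
  show ?case
    using assms(1) by (simp add: comp_pm_id pm_id_comp)
next
  case (Cons j js)
  have "pm_prod (j # js) n \<circ>\<^sub>m R = pm_pow X (T j) (n j) \<circ>\<^sub>m (R \<circ>\<^sub>m pm_prod js n)"
    using Cons by (simp add: map_comp_assoc)
  also have "\<dots> = R \<circ>\<^sub>m pm_prod (j # js) n"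
    using Cons.prems assms(1) by (simp add: map_comp_assoc[symmetric] pm_pow_commute)
  finally show ?case .
qed

text \<open>In the inductive step the \<open>n\<close>-th power of the head has to move past the
  \<open>m\<close>-product of the tail, which the pairwise commutation of the maps allows.\<close>

lemma pm_prod_add:
  assumes "\<And>j. j \<in> set js \<Longrightarrow> pm_on X (T j)"
    and "\<And>i j. i \<in> set js \<Longrightarrow> j \<in> set js \<Longrightarrow> T i \<circ>\<^sub>m T j = T j \<circ>\<^sub>m T i"
  shows "pm_prod js (\<lambda>j. m j + n j) = pm_prod js m \<circ>\<^sub>m pm_prod js n"
  using assms
proof (induction js)
  case Nil
  show ?case
    by (simp add: comp_pm_id pm_on_pm_id)
next
  case (Cons j js)
  let ?p = "\<lambda>n. pm_pow X (T j) (n j)"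
  have "?p n \<circ>\<^sub>m T i = T i \<circ>\<^sub>m ?p n" if "i \<in> set js" for i
    using Cons.prems that by (intro pm_pow_commute) auto
  then have comm: "pm_prod js m \<circ>\<^sub>m ?p n = ?p n \<circ>\<^sub>m pm_prod js m"
    using Cons.prems by (intro pm_prod_commute) (auto simp: pm_on_pow)
  have "pm_prod (j # js) (\<lambda>j. m j + n j)
      = ?p m \<circ>\<^sub>m ((?p n \<circ>\<^sub>m pm_prod js m) \<circ>\<^sub>m pm_prod js n)"
    using Cons by (simp add: pm_pow_add map_comp_assoc)
  also have "\<dots> = pm_prod (j # js) m \<circ>\<^sub>m pm_prod (j # js) n"
    by (simp add: comm[symmetric] map_comp_assoc)
  finally show ?case .
qed

lemma pm_prod_zero: "(\<And>j. j \<in> set js \<Longrightarrow> n j = 0) \<Longrightarrow> pm_prod js n = pm_id X"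
  by (induction js) (simp_all add: comp_pm_id pm_on_pm_id)

lemma pm_prod_unit:
  assumes "distinct js" "j \<in> set js" "pm_on X (T j)"
  shows "pm_prod js (\<lambda>i. if i = j then 1 else 0) = T j"
  using assms(1,2)
proof (induction js)
  case (Cons i js)
  show ?case
  proof (cases "i = j")
    case True
    then have "pm_prod js (\<lambda>i. if i = j then 1 else 0) = pm_id X"
      using Cons.prems by (intro pm_prod_zero) auto
    then show ?thesis
      using True assms(3) by (simp add: comp_pm_id)
  next
    case False
    then show ?thesis
      using Cons assms(3) by (simp add: pm_id_comp)
  qed
qed simp

end

section \<open>Germs of the pseudogroup of a system\<close>

locale mgds_dc =
  fixes X :: "'a topology" and r :: nat and T :: "nat \<Rightarrow> ('a \<rightharpoonup> 'a)"
  assumes mgds: "mgds X r T" and dc: "domain_condition X r T"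
begin

abbreviation P :: "(nat \<Rightarrow> nat) \<Rightarrow> ('a \<rightharpoonup> 'a)" where
  "P \<equiv> mpow X r T"

abbreviation H :: "('a \<rightharpoonup> 'a) set" where
  "H \<equiv> mgds_pseudogroup X r T"

text \<open>Says that the germ of \<open>S\<close> at \<open>y\<close> is the value of the canonical
  map for the exponents \<open>m\<close> and \<open>n\<close>. In this form no local inverse and no
  injectivity neighbourhood has to be chosen, which makes the relation easy to shift, invert and
  compose.\<close>

abbreviation lift :: "(nat \<Rightarrow> nat) \<Rightarrow> (nat \<Rightarrow> nat) \<Rightarrow> ('a \<rightharpoonup> 'a) \<Rightarrow> 'a \<Rightarrow> bool" where
  "lift m n S y \<equiv> agree_near X y (P m \<circ>\<^sub>m S) (P n)"

section \<open>Exponent laws for the powers and their local membership in the pseudogroup\<close>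

lemma local_homeo_T: "j < r \<Longrightarrow> open_local_homeo X (T j)"
  using mgds by (simp add: mgds_def)

lemma pm_on_T: "j < r \<Longrightarrow> pm_on X (T j)"
  using local_homeo_T[of j] openin_subset by (fastforce simp: open_local_homeo_def pm_on_def)

lemma mpow_add: "P (\<lambda>j. m j + n j) = P m \<circ>\<^sub>m P n"
  unfolding mpow_def using mgds by (intro pm_prod_add) (auto simp: pm_on_T mgds_def)

lemma mpow_zero: "P (\<lambda>_. 0) = pm_id X"
  unfolding mpow_def by (intro pm_prod_zero) simp

lemma mpow_unit: "j < r \<Longrightarrow> P (\<lambda>i. if i = j then 1 else 0) = T j"
  unfolding mpow_def by (intro pm_prod_unit) (auto simp: pm_on_T)

lemma mpow_diff:
  assumes "\<And>j. m j \<le> p j"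
  shows "P p = P (\<lambda>j. p j - m j) \<circ>\<^sub>m P m"
  using mpow_add[of "\<lambda>j. p j - m j" m] assms by simp

lemma pm_on_mpow: "pm_on X (P n)"
  unfolding mpow_def by (intro pm_on_prod) (simp add: pm_on_T)

text \<open>Every appeal to the domain condition goes through this pointwise form.\<close>

lemma mpow_max_defined:
  assumes "m \<in> multi_idx r" "n \<in> multi_idx r" "x \<in> dom (P m)" "x \<in> dom (P n)"
  shows "x \<in> dom (P (\<lambda>j. max (m j) (n j)))"
  using dc assms unfolding domain_condition_def by blast

lemma full_H: "full_pseudogroup X H"
  unfolding mgds_pseudogroup_def
proof (rule full_pseudogroup_generated)
  fix S assume "S \<in> {T j |` U | j U. j < r \<and> open_inj X (T j) U}"
  then obtain j U where S: "S = T j |` U" "j < r" "open_inj X (T j) U"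
    by blast
  show "open_homeo X S"
    unfolding S(1)
  proof (rule open_homeo_restrict[OF S(3)])
    fix x assume "x \<in> U"
    then have "x \<in> dom (T j)"
      using S(3) by (auto simp: open_inj_def)
    then show "\<exists>V. openin X V \<and> x \<in> V \<and> open_homeo X (T j |` V)"
      using local_homeo_T[OF S(2)] unfolding open_local_homeo_def by blast
  qed
qed

lemma pseudogroup_H: "pseudogroup X H"
  using full_H by (simp add: full_pseudogroup_def)

lemma
  shows H_id: "pm_id X \<in> H"
    and H_comp: "S \<in> H \<Longrightarrow> S' \<in> H \<Longrightarrow> S \<circ>\<^sub>m S' \<in> H"
    and H_inv: "S \<in> H \<Longrightarrow> pm_inv S \<in> H"
    and H_open_homeo: "S \<in> H \<Longrightarrow> open_homeo X S"
  using pseudogroup_H by (auto simp: pseudogroup_def)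

lemma locally_in_T:
  assumes j: "j < r"
  shows "locally_in X H (T j)"
  unfolding locally_in_def
proof
  fix x assume "x \<in> dom (T j)"
  then obtain U where U: "openin X U" "x \<in> U" "U \<subseteq> dom (T j)" "open_homeo X (T j |` U)"
    using local_homeo_T[OF j] unfolding open_local_homeo_def by blast
  then have "open_inj X (T j) U"
    using inj_on_restrict_map_iff[OF U(3)] open_homeo_inj unfolding open_inj_def by blast
  then have "T j |` U \<in> H"
    using j unfolding mgds_pseudogroup_def generated_full_pseudogroup_def by blast
  then show "\<exists>U. openin X U \<and> x \<in> U \<and> U \<subseteq> dom (T j) \<and> T j |` U \<in> H"
    using U by blast
qed

lemma locally_in_id: "locally_in X H (pm_id X)"
proof -
  have "pm_id X |` topspace X = pm_id X"
    by (simp add: pm_id_def)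
  then show ?thesis
    unfolding locally_in_def by (intro ballI exI[of _ "topspace X"]) (simp add: H_id)
qed

lemma locally_in_mpow: "locally_in X H (P n)"
proof -
  have pow: "locally_in X H (pm_pow X (T j) k)" if "j < r" for j k
    by (induction k) (simp_all add: locally_in_id locally_in_T locally_in_comp pseudogroup_H that)
  have "locally_in X H (pm_prod X T js n)" if "set js \<subseteq> {..<r}" for js
    using that by (induction js) (simp_all add: locally_in_id pow locally_in_comp pseudogroup_H)
  from this[of "[0..<r]"] show ?thesis
    by (simp add: mpow_def atLeast_upt)
qed

lemmas open_dom_mpow = locally_in_dom[OF locally_in_mpow]
  and continuous_mpow = locally_in_continuous[OF pseudogroup_H locally_in_mpow]
  and mpow_restrict_in_H = locally_in_restrict[OF full_H locally_in_mpow]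

section \<open>Calculus of the relations between germs and exponents\<close>

text \<open>\<open>P k\<close> is applied on the left of both sides. Continuity of
  \<open>P n\<close> keeps the values at points near \<open>y\<close> inside the open domain of
  \<open>P k\<close>.\<close>

lemma lift_shift:
  assumes l: "lift m n S y" and z: "P n y = Some z" "z \<in> dom (P k)"
  shows "lift (\<lambda>j. k j + m j) (\<lambda>j. k j + n j) S y"
proof -
  have "agree_near X y (P k \<circ>\<^sub>m P n) (P k \<circ>\<^sub>m (P m \<circ>\<^sub>m S))"
    using agree_near_sym[OF l] z continuous_mpow
    by (intro agree_near_comp[where x = z]) (auto intro: agree_near_refl open_dom_mpow)
  then show ?thesis
    using agree_near_sym by (simp add: mpow_add map_comp_assoc)
qed

lemma liftD: "lift m n S y \<Longrightarrow> S y = Some x \<Longrightarrow> P m x = P n y \<and> x \<in> dom (P m) \<and> y \<in> dom (P n)"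
  by (drule agree_nearD) (auto simp: map_comp_Some_iff)

text \<open>Shift by \<open>p - m\<close>. Since \<open>P p\<close> factors as
  \<open>P (p - m)\<close> after \<open>P m\<close>, the hypothesis that \<open>P p\<close> is
  defined at \<open>x\<close> says exactly that the common value \<open>z\<close> can be shifted.
  Truncated subtraction is exact here because \<open>m\<close> lies below \<open>p\<close>.\<close>

lemma lift_raise:
  assumes l: "lift m n S y" and x: "S y = Some x"
    and p: "\<And>j. m j \<le> p j" "x \<in> dom (P p)"
  shows "lift p (\<lambda>j. p j - m j + n j) S y"
proof -
  obtain z where z: "P m x = Some z" "P n y = Some z"
    using liftD[OF l x] by auto
  then have "z \<in> dom (P (\<lambda>j. p j - m j))"
    using p mpow_diff[OF p(1)] by (auto simp: map_comp_Some_iff)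
  from lift_shift[OF l z(2) this] show ?thesis
    using p(1) by simp
qed

text \<open>Substituting \<open>w\<close> for the inverse image of \<open>v\<close> turns
  \<open>P m (S w) = P n w\<close> into the relation for \<open>pm_inv S\<close> with the exponents
  exchanged; the image of \<open>W\<close> is the new neighbourhood.\<close>

lemma lift_inv:
  assumes S: "open_homeo X S" and x: "S y = Some x" and l: "lift m n S y"
  shows "lift n m (pm_inv S) x"
proof -
  note inv = pm_inv_eq_Some_iff[OF open_homeo_inj[OF S]]
  obtain W where W: "openin X W" "y \<in> W" "agree_on W (P m \<circ>\<^sub>m S) (P n)"
    using l by (auto simp: agree_near_def)
  have "agree_on (pm_image S W) (P n \<circ>\<^sub>m pm_inv S) (P m)"
    unfolding agree_on_def
  proof (intro conjI ballI subsetI)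
    fix v assume "v \<in> pm_image S W"
    then obtain w where w: "w \<in> W" "S w = Some v"
      by (auto simp: pm_image_def)
    then have "P m v = P n w" "w \<in> dom (P n)"
      using W(3) by (auto simp: agree_on_def)
    moreover have "pm_inv S v = Some w"
      using w by (simp add: inv)
    ultimately show "v \<in> dom (P n \<circ>\<^sub>m pm_inv S) \<inter> dom (P m)" "(P n \<circ>\<^sub>m pm_inv S) v = P m v"
      by (auto simp: dom_def)
  qed
  moreover have "openin X (pm_image S W)" "x \<in> pm_image S W"
    using W x open_homeo_image[OF S] by (auto simp: pm_image_def)
  ultimately show ?thesis
    unfolding agree_near_def by blast
qed

text \<open>Counterpart of \<open>lift_raise\<close> that prescribes the right exponent, with
  definedness of \<open>P p\<close> tested at \<open>y\<close> instead of \<open>x\<close>.\<close>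

lemma lift_lower:
  assumes l: "lift m n S y" and p: "\<And>j. n j \<le> p j" "y \<in> dom (P p)"
  shows "lift (\<lambda>j. p j - n j + m j) p S y"
proof -
  obtain z where z: "P n y = Some z"
    using agree_nearD[OF l] by auto
  then have "z \<in> dom (P (\<lambda>j. p j - n j))"
    using p mpow_diff[of n p, OF p(1)] by (auto simp: map_comp_Some_iff)
  from lift_shift[OF l z this] show ?thesis
    using p(1) by simp
qed

text \<open>The inner exponents \<open>n\<close> and \<open>m'\<close> are made equal. Both powers
  are defined at the middle point \<open>y\<close>, so the domain condition admits their maximum
  \<open>p\<close>; then \<open>P a\<close> after \<open>S\<close> is \<open>P p\<close> and
  \<open>P p\<close> after \<open>S'\<close> is \<open>P b\<close>, which chain together.\<close>

lemma lift_comp: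
  assumes idx: "m \<in> multi_idx r" "n \<in> multi_idx r" "m' \<in> multi_idx r" "n' \<in> multi_idx r"
    and l: "lift m n S y" "lift m' n' S' w" and x: "S y = Some x" and y: "S' w = Some y"
    and S': "open_homeo X S'"
  obtains a b where "a \<in> multi_idx r" "b \<in> multi_idx r"
    "idx_diff a b = (\<lambda>j. idx_diff m n j + idx_diff m' n' j)" "lift a b (S \<circ>\<^sub>m S') w"
proof -
  define p where "p = (\<lambda>j. max (n j) (m' j))"
  have le: "n j \<le> p j" "m' j \<le> p j" for j
    by (auto simp: p_def)
  have yp: "y \<in> dom (P p)"
    unfolding p_def using mpow_max_defined idx liftD[OF l(1) x] liftD[OF l(2) y] by blast
  define a where "a = (\<lambda>j. p j - n j + m j)"
  define b where "b = (\<lambda>j. p j - m' j + n' j)"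
  have la: "lift a p S y" and lb: "lift p b S' w"
    unfolding a_def b_def using lift_lower[OF l(1) le(1) yp] lift_raise[OF l(2) y le(2) yp] .
  have "agree_near X w ((P a \<circ>\<^sub>m S) \<circ>\<^sub>m S') (P p \<circ>\<^sub>m S')"
    using S' y la by (intro agree_near_comp[where x = y] agree_near_refl)
      (auto intro: open_homeo_dom open_homeo_continuous)
  then have "lift a b (S \<circ>\<^sub>m S') w"
    using agree_near_trans[OF _ lb] by (simp add: map_comp_assoc)
  moreover have "a \<in> multi_idx r" "b \<in> multi_idx r"
    using idx by (auto simp: a_def b_def p_def multi_idx_def)
  moreover have "idx_diff a b = (\<lambda>j. idx_diff m n j + idx_diff m' n' j)"
  proof
    fix j
    show "idx_diff a b j = idx_diff m n j + idx_diff m' n' j"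
      using le[of j] by (simp add: idx_diff_def a_def b_def)
  qed
  ultimately show ?thesis
    using that by blast
qed

lemma lift_cong:
  assumes eq: "agree_near X y S S'" and S: "open_homeo X S" and l: "lift m n S' y"
  shows "lift m n S y"
proof -
  obtain x where x: "S y = Some x" "S' y = Some x"
    using agree_nearD[OF eq] by auto
  have "agree_near X y (P m \<circ>\<^sub>m S) (P m \<circ>\<^sub>m S')"
    using eq x S liftD[OF l x(2)]
    by (intro agree_near_comp[where x = x] agree_near_refl open_dom_mpow open_homeo_continuous) auto
  then show ?thesis
    using l by (rule agree_near_trans)
qed

lemma multi_idx_zero: "(\<lambda>_. 0) \<in> multi_idx r"
  by (simp add: multi_idx_def)

text \<open>
  The maps that locally satisfy such a relation form a full pseudogroup containing the generators;
  closure under composition rests on the domain condition.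
\<close>

lemma H_lift:
  assumes "S \<in> H" "y \<in> dom S"
  obtains m n where "m \<in> multi_idx r" "n \<in> multi_idx r" "lift m n S y"
proof -
  define K where "K = {S. open_homeo X S \<and>
    (\<forall>y\<in>dom S. \<exists>m\<in>multi_idx r. \<exists>n\<in>multi_idx r. lift m n S y)}"
  have "pseudogroup X K"
    unfolding pseudogroup_def
  proof (intro conjI ballI)
    fix S assume "S \<in> K"
    then show "open_homeo X S"
      by (simp add: K_def)
  next
    have "lift (\<lambda>_. 0) (\<lambda>_. 0) (pm_id X) y" if "y \<in> topspace X" for y
      using that by (simp add: mpow_zero comp_pm_id pm_on_pm_id agree_near_refl)
    then show "pm_id X \<in> K"
      using multi_idx_zero by (auto simp: K_def open_homeo_pm_id)
  next
    fix S S' assume S: "S \<in> K" and S': "S' \<in> K"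
    have "\<exists>m\<in>multi_idx r. \<exists>n\<in>multi_idx r. lift m n (S \<circ>\<^sub>m S') w" if w: "w \<in> dom (S \<circ>\<^sub>m S')" for w
    proof -
      obtain y x where y: "S' w = Some y" "S y = Some x"
        using w by (auto simp: map_comp_Some_iff)
      obtain m n where m: "m \<in> multi_idx r" "n \<in> multi_idx r" "lift m n S y"
        using S y unfolding K_def by blast
      obtain m' n' where m': "m' \<in> multi_idx r" "n' \<in> multi_idx r" "lift m' n' S' w"
        using S' y unfolding K_def by blast
      have "open_homeo X S'"
        using S' by (simp add: K_def)
      from lift_comp[OF m(1,2) m'(1,2) m(3) m'(3) y(2,1) this] show ?thesis
        by metis
    qed
    then show "S \<circ>\<^sub>m S' \<in> K"
      using S S' by (simp add: K_def open_homeo_comp)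
  next
    fix S assume S: "S \<in> K"
    then have homeo: "open_homeo X S"
      by (simp add: K_def)
    have "\<exists>m\<in>multi_idx r. \<exists>n\<in>multi_idx r. lift m n (pm_inv S) x" if x: "x \<in> dom (pm_inv S)" for x
    proof -
      obtain y where "pm_inv S x = Some y"
        using x by auto
      then have y: "S y = Some x"
        by (simp add: pm_inv_eq_Some_iff[OF open_homeo_inj[OF homeo]])
      then obtain m n where "m \<in> multi_idx r" "n \<in> multi_idx r" "lift m n S y"
        using S unfolding K_def by blast
      then show ?thesis
        using lift_inv[OF homeo y] by metis
    qed
    then show "pm_inv S \<in> K"
      using homeo by (simp add: K_def open_homeo_pm_inv)
  qed
  moreover have "S \<in> K" if S: "open_homeo X S" "\<forall>x\<in>dom S. \<exists>S'\<in>K. agree_near X x S S'" for S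
  proof -
    have "\<exists>m\<in>multi_idx r. \<exists>n\<in>multi_idx r. lift m n S y" if "y \<in> dom S" for y
    proof -
      obtain S' where S': "S' \<in> K" "agree_near X y S S'"
        using S(2) \<open>y \<in> dom S\<close> by auto
      then obtain m n where "m \<in> multi_idx r" "n \<in> multi_idx r" "lift m n S' y"
        using agree_nearD[OF S'(2)] unfolding K_def by blast
      then show ?thesis
        using lift_cong[OF S'(2) S(1)] by metis
    qed
    then show ?thesis
      using S(1) by (simp add: K_def)
  qed
  ultimately have "full_pseudogroup X K"
    by (simp add: full_pseudogroup_altdef)
  moreover have "T j |` U \<in> K" if j: "j < r" and U: "open_inj X (T j) U" for j U
  proof -
    have "T j |` U \<in> H"
      using locally_in_restrict[OF full_H locally_in_T[OF j] U] .
    then have homeo: "open_homeo X (T j |` U)"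
      by (rule H_open_homeo)
    then have on: "pm_on X (T j |` U)"
      by (simp add: open_homeo_iff pm_on_def)
    \<comment> \<open>With left exponent zero and right exponent the \<open>j\<close>-th unit
      vector, the relation says that the restriction agrees with \<open>T j\<close>.\<close>
    have "lift (\<lambda>_. 0) (\<lambda>i. if i = j then 1 else 0) (T j |` U) y" if "y \<in> U" for y
      using that U j agree_near_restrict[of X U y "T j"] locally_in_dom[OF locally_in_T[OF j]]
      by (auto simp: mpow_zero pm_id_comp[OF on] mpow_unit open_inj_def)
    moreover have "(\<lambda>i. if i = j then 1 else 0) \<in> multi_idx r"
      using j by (simp add: multi_idx_def)
    ultimately have "\<forall>y\<in>dom (T j |` U). \<exists>m\<in>multi_idx r. \<exists>n\<in>multi_idx r. lift m n (T j |` U) y"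
      using multi_idx_zero by (metis IntD2 dom_restrict)
    then show ?thesis
      using homeo by (simp add: K_def)
  qed
  ultimately have "H \<subseteq> K"
    unfolding mgds_pseudogroup_def generated_full_pseudogroup_def by blast
  then show ?thesis
    using assms that unfolding K_def by blast
qed

section \<open>Comparison of two relations at the same point\<close>

text \<open>The domain condition at \<open>x\<close> admits the maximum \<open>p\<close> of the left
  exponents. Raising keeps differences, so \<open>m - n = p - a\<close> and
  \<open>m' - n' = p - a'\<close>, and the two degrees are compared through \<open>a\<close> and
  \<open>a'\<close> alone.\<close>

lemma common_lift:
  assumes idx: "m \<in> multi_idx r" "n \<in> multi_idx r" "m' \<in> multi_idx r" "n' \<in> multi_idx r"
    and l: "lift m n S y" "lift m' n' S' y" and x: "S y = Some x" "S' y = Some x"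
  obtains p a a' where "a \<in> multi_idx r" "a' \<in> multi_idx r" "lift p a S y" "lift p a' S' y"
    "\<And>j. idx_diff m n j - idx_diff m' n' j = idx_diff a' a j" "x \<in> dom (P p)"
proof -
  define p where "p = (\<lambda>j. max (m j) (m' j))"
  have le: "m j \<le> p j" "m' j \<le> p j" for j
    by (auto simp: p_def)
  have xp: "x \<in> dom (P p)"
    unfolding p_def using mpow_max_defined idx liftD[OF l(1) x(1)] liftD[OF l(2) x(2)] by blast
  have "(\<lambda>j. p j - m j + n j) \<in> multi_idx r" "(\<lambda>j. p j - m' j + n' j) \<in> multi_idx r"
    using idx by (auto simp: p_def multi_idx_def)
  moreover have "idx_diff m n j - idx_diff m' n' j
      = idx_diff (\<lambda>j. p j - m' j + n' j) (\<lambda>j. p j - m j + n j) j" for j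
    using le[of j] by (simp add: idx_diff_def)
  ultimately show ?thesis
    using that lift_raise[OF l(1) x(1) le(1) xp] lift_raise[OF l(2) x(2) le(2) xp] xp by blast
qed

lemma idx_diff_eq_0D: "(\<And>j. idx_diff a b j = 0) \<Longrightarrow> a = b"
  by (auto simp: idx_diff_def)

text \<open>This makes the canonical map well defined: equal degrees force \<open>a = a'\<close>, so
  \<open>S\<close> and \<open>S'\<close> have the same composite with \<open>P p\<close> near
  \<open>y\<close>, and local injectivity of \<open>P p\<close> at \<open>x\<close> cancels
  it.\<close>

lemma lift_unique:
  assumes idx: "m \<in> multi_idx r" "n \<in> multi_idx r" "m' \<in> multi_idx r" "n' \<in> multi_idx r"
    and l: "lift m n S y" "lift m' n' S' y" and x: "S y = Some x" "S' y = Some x"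
    and H: "S \<in> H" "S' \<in> H" and eq: "idx_diff m n = idx_diff m' n'"
  shows "agree_near X y S S'"
proof -
  obtain p a a' where p: "lift p a S y" "lift p a' S' y" "x \<in> dom (P p)"
    and d: "\<And>j. idx_diff m n j - idx_diff m' n' j = idx_diff a' a j"
    using common_lift[OF idx l x] by metis
  have "a' = a"
    using d eq by (intro idx_diff_eq_0D) simp
  then have "agree_near X y (P p \<circ>\<^sub>m S) (P p \<circ>\<^sub>m S')"
    using agree_near_trans[OF p(1)] agree_near_sym[OF p(2)] by simp
  then obtain W where W: "openin X W" "y \<in> W" "agree_on W (P p \<circ>\<^sub>m S) (P p \<circ>\<^sub>m S')"
    by (auto simp: agree_near_def)
  obtain U where U: "x \<in> U" "open_inj X (P p) U"
    using locally_in_open_inj[OF pseudogroup_H locally_in_mpow p(3)] .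
  \<comment> \<open>Both maps must take values in the injectivity neighbourhood \<open>U\<close>
    before \<open>P p\<close> can be cancelled.\<close>
  let ?W = "W \<inter> pm_vimage S U \<inter> pm_vimage S' U"
  have "openin X ?W"
    using W U H_open_homeo[OF H(1)] H_open_homeo[OF H(2)]
    by (intro openin_Int) (auto simp: open_inj_def pm_continuous_def dest: open_homeo_continuous)
  moreover have "y \<in> ?W"
    using W U x by (auto simp: pm_vimage_def)
  moreover have "agree_on ?W S S'"
    unfolding agree_on_def
  proof (intro conjI ballI subsetI)
    fix w assume w: "w \<in> ?W"
    then obtain v v' where v: "v \<in> U" "S w = Some v" "v' \<in> U" "S' w = Some v'"
      by (auto simp: pm_vimage_def)
    moreover have "(P p \<circ>\<^sub>m S) w = (P p \<circ>\<^sub>m S') w"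
      using W w by (auto simp: agree_on_def)
    ultimately have "v = v'"
      using U by (simp add: open_inj_def inj_on_def)
    then show "w \<in> dom S \<inter> dom S'" "S w = S' w"
      using v by auto
  qed
  ultimately show ?thesis
    unfolding agree_near_def by blast
qed

lemma lift_free:
  assumes free: "essentially_free X r T"
    and idx: "m \<in> multi_idx r" "n \<in> multi_idx r" "m' \<in> multi_idx r" "n' \<in> multi_idx r"
    and l: "lift m n S y" "lift m' n' S' y"
    and H: "S \<in> H" and eq: "agree_near X y S S'"
  shows "idx_diff m n = idx_diff m' n'"
proof -
  obtain x where x: "S y = Some x" "S' y = Some x"
    using agree_nearD[OF eq] by auto
  obtain p a a' where a: "a \<in> multi_idx r" "a' \<in> multi_idx r"
    and p: "lift p a S y" "lift p a' S' y" "x \<in> dom (P p)"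
    and d: "\<And>j. idx_diff m n j - idx_diff m' n' j = idx_diff a' a j"
    using common_lift[OF idx l x] by metis
  \<comment> \<open>The second relation is transported from \<open>S'\<close> to \<open>S\<close>.
    Both \<open>P a\<close> and \<open>P a'\<close> then agree near \<open>y\<close> with
    \<open>P p\<close> after \<open>S\<close>, and essential freeness applies to them.\<close>
  have "lift p a' S y"
    using lift_cong[OF eq H_open_homeo[OF H] p(2)] .
  from agree_near_trans[OF agree_near_sym[OF p(1)] this]
  have "\<exists>W. openin X W \<and> W \<noteq> {} \<and> agree_on W (P a) (P a')"
    unfolding agree_near_def by blast
  then have "a' = a"
    using free a unfolding essentially_free_def by metis
  then have "idx_diff m n j - idx_diff m' n' j = 0" for j
    using d by (simp add: idx_diff_def)
  then show ?thesis
    by auto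
qed

section \<open>The canonical homomorphism\<close>

abbreviation local_rep where
  "local_rep m n U V \<equiv> pm_inv (P m |` U) \<circ>\<^sub>m (P n |` V)"

abbreviation \<pi> where
  "\<pi> \<equiv> germ_map X r T"

context
  fixes m n :: "nat \<Rightarrow> nat" and U V :: "'a set"
  assumes U: "open_inj X (P m) U" and V: "open_inj X (P n) V"
begin

lemma local_rep_eq_Some_iff:
  "local_rep m n U V w = Some v \<longleftrightarrow> w \<in> V \<and> v \<in> U \<and> P m v = P n w"
proof -
  have "inj_on (P m |` U) (dom (P m |` U))" and sub: "U \<subseteq> dom (P m)"
    using U inj_on_restrict_map_iff[of U "P m"] by (auto simp: open_inj_def)
  then have "local_rep m n U V w = Some v \<longleftrightarrow> w \<in> V \<and> v \<in> U \<and> (\<exists>z. P n w = Some z \<and> P m v = Some z)"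
    by (auto simp: map_comp_Some_iff pm_inv_eq_Some_iff restrict_map_eq_Some_iff)
  then show ?thesis
    using sub by (metis domD subsetD)
qed

lemma local_rep_in_H: "local_rep m n U V \<in> H"
  by (intro H_comp H_inv mpow_restrict_in_H U V)

text \<open>The relation holds on the whole domain of the representative, and this domain is open
  because the representative lies in \<open>H\<close>.\<close>

lemma lift_local_rep:
  assumes "local_rep m n U V w = Some v"
  shows "lift m n (local_rep m n U V) w"
proof -
  let ?R = "local_rep m n U V"
  have V': "V \<subseteq> dom (P n)"
    using V by (simp add: open_inj_def)
  have "agree_on (dom ?R) (P m \<circ>\<^sub>m ?R) (P n)"
    unfolding agree_on_def
  proof (intro conjI ballI subsetI)
    fix w assume "w \<in> dom ?R"
    then obtain v where v: "?R w = Some v"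
      by blast
    then have "P m v = P n w" "w \<in> dom (P n)"
      using local_rep_eq_Some_iff[of w v] V' by auto
    then show "w \<in> dom (P m \<circ>\<^sub>m ?R) \<inter> dom (P n)" "(P m \<circ>\<^sub>m ?R) w = P n w"
      using v by (simp_all add: domIff v map_comp_simps(2)[of ?R w v "P m"])
  qed
  moreover have "openin X (dom ?R)" "w \<in> dom ?R"
    using open_homeo_dom[OF H_open_homeo[OF local_rep_in_H]] assms by auto
  ultimately show ?thesis
    unfolding agree_near_def by blast
qed

end

lemma open_inj_nbhd:
  assumes "x \<in> dom (P m)"
  obtains U where "x \<in> U" "open_inj X (P m) U"
  using locally_in_open_inj[OF pseudogroup_H locally_in_mpow assms] .

text \<open>By \<open>lift_unique\<close> every candidate in the description that defines
  \<open>germ_map\<close> is the germ of \<open>S\<close>, and injectivity neighbourhoods provide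
  one. Hence the map can be evaluated with any \<open>S\<close> that satisfies the relation.\<close>

lemma germ_map_eq:
  assumes idx: "m \<in> multi_idx r" "n \<in> multi_idx r"
    and S: "S \<in> H" "S y = Some x" "lift m n S y"
  shows "\<pi> (x, idx_diff m n, y) = germ X H x S y"
proof -
  let ?Q = "\<lambda>g. \<exists>m'\<in>multi_idx r. \<exists>n'\<in>multi_idx r. \<exists>U V.
     idx_diff m n = idx_diff m' n' \<and> P m' x = P n' y \<and>
     x \<in> U \<and> open_inj X (P m') U \<and> y \<in> V \<and> open_inj X (P n') V \<and>
     g = germ X H x (local_rep m' n' U V) y"
  have eq: "germ X H x (local_rep m' n' U V) y = germ X H x S y"
    if "m' \<in> multi_idx r" "n' \<in> multi_idx r" "idx_diff m n = idx_diff m' n'" "P m' x = P n' y"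
      "x \<in> U" "open_inj X (P m') U" "y \<in> V" "open_inj X (P n') V" for m' n' U V
  proof -
    have R: "local_rep m' n' U V y = Some x"
      using that by (simp add: local_rep_eq_Some_iff)
    have "agree_near X y (local_rep m' n' U V) S"
      using lift_unique[OF that(1,2) idx lift_local_rep[OF that(6,8) R] S(3) R S(2)
          local_rep_in_H[OF that(6,8)] S(1) that(3)[symmetric]] .
    then show ?thesis
      using S R local_rep_in_H[OF that(6,8)] by (simp add: germ_eq_iff[OF pseudogroup_H] germ_reps_def)
  qed
  have xy: "P m x = P n y" "x \<in> dom (P m)" "y \<in> dom (P n)"
    using liftD[OF S(3,2)] by auto
  obtain U where U: "x \<in> U" "open_inj X (P m) U"
    using open_inj_nbhd[OF xy(2)] .
  obtain V where V: "y \<in> V" "open_inj X (P n) V"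
    using open_inj_nbhd[OF xy(3)] .
  have "(THE g. ?Q g) = germ X H x S y"
  proof (rule the_equality)
    show "?Q (germ X H x S y)"
      using idx xy U V eq[OF idx refl xy(1) U V] by metis
    show "g = germ X H x S y" if "?Q g" for g
      using that eq by metis
  qed
  then show ?thesis
    by (simp add: germ_map_def)
qed

lemma sdp_arrowsI:
  assumes "m \<in> multi_idx r" "n \<in> multi_idx r" "S y = Some x" "lift m n S y"
  shows "(x, idx_diff m n, y) \<in> sdp_arrows X r T"
  using assms liftD[OF assms(4,3)] unfolding sdp_arrows_def by blast

lemma sdp_arrowsE:
  assumes "(x, z, y) \<in> sdp_arrows X r T"
  obtains m n S where "m \<in> multi_idx r" "n \<in> multi_idx r" "z = idx_diff m n"
    "S \<in> H" "S y = Some x" "lift m n S y" "\<pi> (x, z, y) = germ X H x S y"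
proof -
  obtain m n where mn: "m \<in> multi_idx r" "n \<in> multi_idx r" "z = idx_diff m n"
    "x \<in> dom (P m)" "y \<in> dom (P n)" "P m x = P n y"
    using assms unfolding sdp_arrows_def by blast
  obtain U where U: "x \<in> U" "open_inj X (P m) U"
    using open_inj_nbhd[OF mn(4)] .
  obtain V where V: "y \<in> V" "open_inj X (P n) V"
    using open_inj_nbhd[OF mn(5)] .
  have R: "local_rep m n U V y = Some x"
    using U V mn by (simp add: local_rep_eq_Some_iff)
  show ?thesis
    using that[OF mn(1-3) local_rep_in_H[OF U(2) V(2)] R lift_local_rep[OF U(2) V(2) R]]
      germ_map_eq[OF mn(1,2) local_rep_in_H[OF U(2) V(2)] R lift_local_rep[OF U(2) V(2) R]] mn(3)
    by simp
qed

section \<open>The two topologies, the homomorphism property and continuity\<close>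

abbreviation \<G> where
  "\<G> \<equiv> sdp_groupoid X r T"

abbreviation \<H> where
  "\<H> \<equiv> mgds_germ_groupoid X r T"

lemma arrows_sdp: "arrows \<G> = sdp_arrows X r T"
  by (simp add: sdp_groupoid_def)

lemma sdp_basic_open:
  assumes "m \<in> multi_idx r" "n \<in> multi_idx r" "open_inj X (P m) U" "open_inj X (P n) V"
  shows "openin (gtop \<G>) (sdp_basic X r T U m n V)"
  using assms unfolding sdp_groupoid_def by (auto intro!: topology_generated_by_Basis)

lemma sdp_basic_subset:
  assumes "m \<in> multi_idx r" "n \<in> multi_idx r" "open_inj X (P m) U" "open_inj X (P n) V"
  shows "sdp_basic X r T U m n V \<subseteq> sdp_arrows X r T"
  using assms unfolding sdp_basic_def sdp_arrows_def open_inj_def by blast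

lemma topspace_sdp: "topspace (gtop \<G>) = sdp_arrows X r T"
proof
  have "topspace (gtop \<G>) = \<Union>{sdp_basic X r T U m n V | U m n V.
      m \<in> multi_idx r \<and> n \<in> multi_idx r \<and> open_inj X (P m) U \<and> open_inj X (P n) V}"
    by (simp add: sdp_groupoid_def topology_generated_by_topspace)
  then show "topspace (gtop \<G>) \<subseteq> sdp_arrows X r T"
    using sdp_basic_subset by blast
  show "sdp_arrows X r T \<subseteq> topspace (gtop \<G>)"
  proof
    fix g assume "g \<in> sdp_arrows X r T"
    then obtain x m n y where g: "g = (x, idx_diff m n, y)" "m \<in> multi_idx r" "n \<in> multi_idx r"
      "x \<in> dom (P m)" "y \<in> dom (P n)" "P m x = P n y"
      unfolding sdp_arrows_def by blast
    obtain U where U: "x \<in> U" "open_inj X (P m) U"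
      using open_inj_nbhd[OF g(4)] .
    obtain V where V: "y \<in> V" "open_inj X (P n) V"
      using open_inj_nbhd[OF g(5)] .
    have "g \<in> sdp_basic X r T U m n V"
      using g U V by (auto simp: sdp_basic_def)
    then show "g \<in> topspace (gtop \<G>)"
      using sdp_basic_open[OF g(2,3) U(2) V(2)] openin_subset by blast
  qed
qed

lemma germ_basic_open:
  assumes "S \<in> H" "openin X W" "W \<subseteq> dom S"
  shows "openin (gtop \<H>) {germ X H (the (S y)) S y | y. y \<in> W}"
  using assms unfolding germ_groupoid_def by (auto intro!: topology_generated_by_Basis)

lemma topspace_germ: "topspace (gtop \<H>) = arrows \<H>"
proof
  show "topspace (gtop \<H>) \<subseteq> arrows \<H>"
  proof
    fix h assume "h \<in> topspace (gtop \<H>)"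
    then obtain S W y where "h = germ X H (the (S y)) S y" "S \<in> H" "W \<subseteq> dom S" "y \<in> W"
      by (auto simp: germ_groupoid_def topology_generated_by_topspace)
    then have "h = germ X H (the (S y)) S y" "S \<in> H" "y \<in> dom S"
      by auto
    then show "h \<in> arrows \<H>"
      by (auto intro!: germ_in_arrows simp: germ_reps_def)
  qed
  show "arrows \<H> \<subseteq> topspace (gtop \<H>)"
  proof
    fix h assume "h \<in> arrows \<H>"
    then obtain x S y where h: "h = germ X H x S y" "S \<in> H" "S y = Some x"
      by (auto elim!: arrows_germ_groupoidE simp: germ_reps_def)
    then have "h \<in> {germ X H (the (S y)) S y | y. y \<in> dom S}"
      by (intro CollectI exI[of _ y]) auto
    then show "h \<in> topspace (gtop \<H>)"
      using germ_basic_open[OF h(2) open_homeo_dom[OF H_open_homeo[OF h(2)]]] openin_subset by blast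
  qed
qed

lemma germ_map_mult:
  assumes "(x, z, y) \<in> sdp_arrows X r T" "(y, z', w) \<in> sdp_arrows X r T"
  shows "(x, \<lambda>j. z j + z' j, w) \<in> sdp_arrows X r T"
    and "\<pi> (x, \<lambda>j. z j + z' j, w) = gmult \<H> (\<pi> (x, z, y)) (\<pi> (y, z', w))"
    and "(\<pi> (x, z, y), \<pi> (y, z', w)) \<in> composable \<H>"
proof -
  obtain m n S where S: "m \<in> multi_idx r" "n \<in> multi_idx r" "z = idx_diff m n"
    "S \<in> H" "S y = Some x" "lift m n S y" "\<pi> (x, z, y) = germ X H x S y"
    using sdp_arrowsE[OF assms(1)] .
  obtain m' n' S' where S': "m' \<in> multi_idx r" "n' \<in> multi_idx r" "z' = idx_diff m' n'"
    "S' \<in> H" "S' w = Some y" "lift m' n' S' w" "\<pi> (y, z', w) = germ X H y S' w"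
    using sdp_arrowsE[OF assms(2)] .
  obtain a b where ab: "a \<in> multi_idx r" "b \<in> multi_idx r"
    "idx_diff a b = (\<lambda>j. idx_diff m n j + idx_diff m' n' j)" "lift a b (S \<circ>\<^sub>m S') w"
    using lift_comp[OF S(1,2) S'(1,2) S(6) S'(6) S(5) S'(5) H_open_homeo[OF S'(4)]] .
  have SS': "(S \<circ>\<^sub>m S') w = Some x"
    using S(5) S'(5) by (simp add: map_comp_Some_iff)
  have reps: "(x, S, y) \<in> germ_reps H" "(y, S', w) \<in> germ_reps H"
    using S S' by (auto simp: germ_reps_def)
  show "(x, \<lambda>j. z j + z' j, w) \<in> sdp_arrows X r T"
    using sdp_arrowsI[OF ab(1,2) SS' ab(4)] ab(3) S(3) S'(3) by simp
  show "\<pi> (x, \<lambda>j. z j + z' j, w) = gmult \<H> (\<pi> (x, z, y)) (\<pi> (y, z', w))"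
    using germ_map_eq[OF ab(1,2) H_comp[OF S(4) S'(4)] SS' ab(4)] ab(3) S(3,7) S'(3,7)
      gmult_germ[OF pseudogroup_H reps] by simp
  show "(\<pi> (x, z, y), \<pi> (y, z', w)) \<in> composable \<H>"
    using germ_composableI[OF reps] S(7) S'(7) by simp
qed

lemma germ_map_inv:
  assumes "(x, z, y) \<in> sdp_arrows X r T"
  shows "(y, \<lambda>j. - z j, x) \<in> sdp_arrows X r T"
    and "\<pi> (y, \<lambda>j. - z j, x) = ginv \<H> (\<pi> (x, z, y))"
proof -
  obtain m n S where S: "m \<in> multi_idx r" "n \<in> multi_idx r" "z = idx_diff m n"
    "S \<in> H" "S y = Some x" "lift m n S y" "\<pi> (x, z, y) = germ X H x S y"
    using sdp_arrowsE[OF assms] .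
  note homeo = H_open_homeo[OF S(4)]
  have z: "(\<lambda>j. - z j) = idx_diff n m"
    using S(3) by (auto simp: idx_diff_def)
  have inv: "pm_inv S x = Some y"
    using S(5) by (simp add: pm_inv_eq_Some_iff[OF open_homeo_inj[OF homeo]])
  have l: "lift n m (pm_inv S) x"
    using lift_inv[OF homeo S(5,6)] .
  have rep: "(x, S, y) \<in> germ_reps H"
    using S by (auto simp: germ_reps_def)
  show "(y, \<lambda>j. - z j, x) \<in> sdp_arrows X r T"
    using sdp_arrowsI[OF S(2,1) inv l] z by simp
  show "\<pi> (y, \<lambda>j. - z j, x) = ginv \<H> (\<pi> (x, z, y))"
    using germ_map_eq[OF S(2,1) H_inv[OF S(4)] inv l] z S(7) ginv_germ[OF pseudogroup_H rep] by simp
qed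

lemma germ_map_in_arrows:
  assumes "g \<in> sdp_arrows X r T"
  shows "\<pi> g \<in> arrows \<H>"
proof -
  obtain x z y where g: "g = (x, z, y)"
    by (cases g)
  show ?thesis
    using assms unfolding g by (elim sdp_arrowsE) (simp add: germ_in_arrows germ_reps_def)
qed

lemma continuous_germ_map: "continuous_map (gtop \<G>) (gtop \<H>) \<pi>"
proof -
  let ?\<B> = "{{germ X H (the (S y)) S y | y. y \<in> W} | S W. S \<in> H \<and> openin X W \<and> W \<subseteq> dom S}"
  have gtop: "gtop \<H> = topology_generated_by ?\<B>"
    by (simp add: germ_groupoid_def)
  have *: "openin (gtop \<G>) (\<pi> -` B \<inter> topspace (gtop \<G>))"
    if B: "B = {germ X H (the (S y)) S y | y. y \<in> W}"
      and S: "S \<in> H" and W: "openin X W" "W \<subseteq> dom S" for B S W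
  proof (subst openin_subopen, intro ballI)
    fix g assume g: "g \<in> \<pi> -` B \<inter> topspace (gtop \<G>)"
    note homeo = H_open_homeo[OF S]
    obtain x z y where xzy: "g = (x, z, y)"
      by (cases g)
    have "(x, z, y) \<in> sdp_arrows X r T"
      using g xzy topspace_sdp by simp
    then obtain m n R where R: "m \<in> multi_idx r" "n \<in> multi_idx r" "z = idx_diff m n"
      "R \<in> H" "R y = Some x" "lift m n R y" "\<pi> (x, z, y) = germ X H x R y"
      by (rule sdp_arrowsE)
    obtain w where w: "w \<in> W" "germ X H x R y = germ X H (the (S w)) S w"
      using g xzy R(7) B by auto
    obtain v where v: "S w = Some v"
      using w W by auto
    have "germ X H x R y = germ X H v S w"
      using w v by simp
    moreover have "(x, R, y) \<in> germ_reps H" "(v, S, w) \<in> germ_reps H"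
      using R S v by (auto simp: germ_reps_def)
    ultimately have eq: "x = v" "y = w" "agree_near X y R S"
      using germ_eq_iff[OF pseudogroup_H] by metis+
    have "lift m n S y"
      using lift_cong[OF agree_near_sym[OF eq(3)] homeo R(6)] .
    then obtain W' where W': "openin X W'" "y \<in> W'" "agree_on W' (P m \<circ>\<^sub>m S) (P n)"
      by (auto simp: agree_near_def)
    obtain U where U: "x \<in> U" "open_inj X (P m) U"
      using open_inj_nbhd liftD[OF R(6,5)] by blast
    obtain V where V: "y \<in> V" "open_inj X (P n) V"
      using open_inj_nbhd liftD[OF R(6,5)] by blast
    \<comment> \<open>The factor \<open>pm_vimage S U\<close> forces \<open>S y'\<close> into
      \<open>U\<close>. For an arrow \<open>(x', m - n, y')\<close> of the basic set, injectivity of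
      \<open>P m\<close> on \<open>U\<close> then gives \<open>x' = S y'\<close>, so the arrow is
      sent to the germ of \<open>S\<close> at \<open>y'\<close>.\<close>
    let ?V = "V \<inter> W \<inter> W' \<inter> pm_vimage S U"
    have "openin X ?V"
      using U V W W' open_homeo_continuous[OF homeo] by (auto simp: open_inj_def pm_continuous_def)
    then have oV: "open_inj X (P n) ?V"
      using V(2) by (auto simp: open_inj_def inj_on_def)
    have "sdp_basic X r T U m n ?V \<subseteq> \<pi> -` B \<inter> topspace (gtop \<G>)"
    proof
      fix g' assume g': "g' \<in> sdp_basic X r T U m n ?V"
      then obtain x' y' where g'_eq: "g' = (x', idx_diff m n, y')" and x': "x' \<in> U" "y' \<in> ?V"
        "P m x' = P n y'"
        by (auto simp: sdp_basic_def)
      obtain u where u: "S y' = Some u" "u \<in> U"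
        using x' by (auto simp: pm_vimage_def)
      have l: "lift m n S y'"
        using W' x' unfolding agree_near_def by blast
      have "P m u = P m x'"
        using liftD[OF l u(1)] x'(3) by simp
      then have "u = x'"
        using U(2) u x' by (simp add: open_inj_def inj_on_def)
      then have "\<pi> g' = germ X H (the (S y')) S y'"
        using germ_map_eq[OF R(1,2) S u(1) l] u g'_eq by simp
      then show "g' \<in> \<pi> -` B \<inter> topspace (gtop \<G>)"
        using x' B topspace_sdp g' sdp_basic_subset[OF R(1,2) U(2) oV] by blast
    qed
    moreover have "g \<in> sdp_basic X r T U m n ?V"
      using R(3) xzy U V W' w v eq liftD[OF R(6,5)] by (auto simp: sdp_basic_def pm_vimage_def)
    ultimately show "\<exists>N. openin (gtop \<G>) N \<and> g \<in> N \<and> N \<subseteq> \<pi> -` B \<inter> topspace (gtop \<G>)"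
      using sdp_basic_open[OF R(1,2) U(2) oV] by blast
  qed
  have "\<forall>B\<in>?\<B>. openin (gtop \<G>) (\<pi> -` B \<inter> topspace (gtop \<G>))"
    by (intro ballI, elim CollectE exE conjE) (rule *)
  moreover have "\<pi> ` topspace (gtop \<G>) \<subseteq> \<Union>?\<B>"
  proof -
    have "\<Union>?\<B> = topspace (gtop \<H>)"
      unfolding gtop topology_generated_by_topspace ..
    then show ?thesis
      using germ_map_in_arrows topspace_germ topspace_sdp by auto
  qed
  ultimately show ?thesis
    unfolding gtop continuous_on_generated_topo_iff by blast
qed

lemma sdp_mult: "gmult \<G> (x, z, y) (y', z', w) = (x, \<lambda>j. z j + z' j, w)"
  and sdp_inv: "ginv \<G> (x, z, y) = (y, \<lambda>j. - z j, x)"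
  and sdp_composable: "((x, z, y), (y', z', w)) \<in> composable \<G> \<longleftrightarrow>
    (x, z, y) \<in> sdp_arrows X r T \<and> (y', z', w) \<in> sdp_arrows X r T \<and> y = y'"
  by (auto simp: sdp_groupoid_def)

lemma germ_map_hom: "tgroupoid_hom \<G> \<H> \<pi>"
  unfolding tgroupoid_hom_def
proof (intro conjI)
  show "\<pi> ` arrows \<G> \<subseteq> arrows \<H>"
    using germ_map_in_arrows arrows_sdp by auto
  show "\<forall>(g, h)\<in>composable \<G>. (\<pi> g, \<pi> h) \<in> composable \<H> \<and> \<pi> (gmult \<G> g h) = gmult \<H> (\<pi> g) (\<pi> h)"
    using germ_map_mult by (auto simp: sdp_composable sdp_mult)
  show "\<forall>g\<in>arrows \<G>. \<pi> (ginv \<G> g) = ginv \<H> (\<pi> g)"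
    using germ_map_inv by (auto simp: arrows_sdp sdp_inv)
qed (rule continuous_germ_map)

section \<open>Surjectivity, injectivity and openness of the canonical map\<close>

lemma germ_map_surj:
  assumes "(x, S, y) \<in> germ_reps H"
  obtains z where "(x, z, y) \<in> sdp_arrows X r T" "\<pi> (x, z, y) = germ X H x S y"
proof -
  have S: "S \<in> H" "S y = Some x"
    using assms by (auto simp: germ_reps_def)
  then obtain m n where "m \<in> multi_idx r" "n \<in> multi_idx r" "lift m n S y"
    using H_lift[of S y] by blast
  then show ?thesis
    using S that sdp_arrowsI germ_map_eq by metis
qed

lemma germ_map_inj:
  assumes free: "essentially_free X r T"
  shows "inj_on \<pi> (sdp_arrows X r T)"
proof (rule inj_onI)
  fix g g' assume g: "g \<in> sdp_arrows X r T" "g' \<in> sdp_arrows X r T" "\<pi> g = \<pi> g'"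
  obtain x z y x' z' y' where xzy: "g = (x, z, y)" "g' = (x', z', y')"
    by (cases g, cases g')
  obtain m n S where S: "m \<in> multi_idx r" "n \<in> multi_idx r" "z = idx_diff m n"
    "S \<in> H" "S y = Some x" "lift m n S y" "\<pi> (x, z, y) = germ X H x S y"
    using g(1) unfolding xzy(1) by (rule sdp_arrowsE)
  obtain m' n' S' where S': "m' \<in> multi_idx r" "n' \<in> multi_idx r" "z' = idx_diff m' n'"
    "S' \<in> H" "S' y' = Some x'" "lift m' n' S' y'" "\<pi> (x', z', y') = germ X H x' S' y'"
    using g(2) unfolding xzy(2) by (rule sdp_arrowsE)
  have "germ X H x S y = germ X H x' S' y'"
    using g(3) xzy S(7) S'(7) by simp
  moreover have "(x, S, y) \<in> germ_reps H" "(x', S', y') \<in> germ_reps H"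
    using S(4,5) S'(4,5) by (auto simp: germ_reps_def)
  ultimately have eq: "x = x'" "y = y'" "agree_near X y S S'"
    using germ_eq_iff[OF pseudogroup_H] by metis+
  then have "z = z'"
    using lift_free[OF free S(1,2) S'(1,2) S(6) _ S(4)] S(3) S'(3,6) by metis
  then show "g = g'"
    using eq xzy by simp
qed

text \<open>The end points of the arrows in a basic set form precisely the graph of
  \<open>local_rep m n U V\<close>. The image is therefore the basic set of all germs of this one
  map.\<close>

lemma germ_map_open:
  assumes "m \<in> multi_idx r" "n \<in> multi_idx r" "open_inj X (P m) U" "open_inj X (P n) V"
  shows "openin (gtop \<H>) (\<pi> ` sdp_basic X r T U m n V)"
proof -
  let ?R = "local_rep m n U V"
  have R: "?R \<in> H"
    using local_rep_in_H[OF assms(3,4)] .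
  note iff = local_rep_eq_Some_iff[OF assms(3,4)]
  have eq: "\<pi> (x, idx_diff m n, y) = germ X H x ?R y" if "?R y = Some x" for x y
    using germ_map_eq[OF assms(1,2) R that lift_local_rep[OF assms(3,4) that]] .
  have "sdp_basic X r T U m n V = {(x, idx_diff m n, y) | x y. ?R y = Some x}"
    unfolding sdp_basic_def iff by blast
  then have "\<pi> ` sdp_basic X r T U m n V = {\<pi> (x, idx_diff m n, y) | x y. ?R y = Some x}"
    by auto
  also have "\<dots> = {germ X H x ?R y | x y. ?R y = Some x}"
    using eq by (metis (no_types, lifting))
  also have "\<dots> = {germ X H (the (?R y)) ?R y | y. y \<in> dom ?R}"
    unfolding dom_def by force
  finally show ?thesis
    using germ_basic_open[OF R open_homeo_dom[OF H_open_homeo[OF R]]] by simp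
qed

section \<open>The two implications of the equivalence\<close>

lemma essentially_free_imp_iso:
  assumes free: "essentially_free X r T"
  shows "tgroupoid_iso \<G> \<H> \<pi>"
proof -
  define \<psi> where "\<psi> = inv_into (sdp_arrows X r T) \<pi>"
  have \<psi>\<pi>: "\<psi> (\<pi> g) = g" if "g \<in> sdp_arrows X r T" for g
    unfolding \<psi>_def using germ_map_inj[OF free] that by (rule inv_into_f_f)
  have arr: "\<exists>g\<in>sdp_arrows X r T. \<pi> g = h" if "h \<in> arrows \<H>" for h
    using that by (elim arrows_germ_groupoidE) (metis germ_map_surj)
  have \<pi>\<psi>: "\<pi> (\<psi> h) = h" if "h \<in> arrows \<H>" for h
    using arr[OF that] \<psi>\<pi> by auto
  have \<psi>_arrows: "\<psi> ` arrows \<H> \<subseteq> sdp_arrows X r T"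
  proof (rule image_subsetI)
    fix h assume "h \<in> arrows \<H>"
    then show "\<psi> h \<in> sdp_arrows X r T"
      using arr \<psi>\<pi> by metis
  qed
  have "tgroupoid_hom \<H> \<G> \<psi>"
    unfolding tgroupoid_hom_def
  proof (intro conjI)
    show "\<psi> ` arrows \<H> \<subseteq> arrows \<G>"
      using \<psi>_arrows arrows_sdp by simp
    show "\<forall>(g, h)\<in>composable \<H>. (\<psi> g, \<psi> h) \<in> composable \<G> \<and> \<psi> (gmult \<H> g h) = gmult \<G> (\<psi> g) (\<psi> h)"
    proof (intro ballI, clarify)
      fix g h assume "(g, h) \<in> composable \<H>"
      then obtain x S y S' w where gh: "g = germ X H x S y" "h = germ X H y S' w"
        and reps: "(x, S, y) \<in> germ_reps H" "(y, S', w) \<in> germ_reps H"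
        by (auto simp: germ_groupoid_def)
      \<comment> \<open>Surjectivity preserves end points, so the chosen preimages share the middle
        point \<open>y\<close> and are composable in the semidirect product groupoid.\<close>
      obtain z where z: "(x, z, y) \<in> sdp_arrows X r T" "\<pi> (x, z, y) = g"
        using germ_map_surj[OF reps(1)] gh(1) by metis
      obtain z' where z': "(y, z', w) \<in> sdp_arrows X r T" "\<pi> (y, z', w) = h"
        using germ_map_surj[OF reps(2)] gh(2) by metis
      have "\<psi> g = (x, z, y)" "\<psi> h = (y, z', w)"
        using \<psi>\<pi>[OF z(1)] \<psi>\<pi>[OF z'(1)] z z' by simp_all
      moreover have "\<psi> (gmult \<H> g h) = (x, \<lambda>j. z j + z' j, w)"
        using germ_map_mult(1,2)[OF z(1) z'(1)] \<psi>\<pi> z z' by metis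
      ultimately show "(\<psi> g, \<psi> h) \<in> composable \<G> \<and> \<psi> (gmult \<H> g h) = gmult \<G> (\<psi> g) (\<psi> h)"
        using z z' by (simp add: sdp_mult sdp_composable)
    qed
    show "\<forall>g\<in>arrows \<H>. \<psi> (ginv \<H> g) = ginv \<G> (\<psi> g)"
    proof
      fix h assume "h \<in> arrows \<H>"
      then obtain x z y where g: "(x, z, y) \<in> sdp_arrows X r T" "\<pi> (x, z, y) = h"
        using arr by (metis prod_cases3)
      then have "\<psi> (ginv \<H> h) = (y, \<lambda>j. - z j, x)"
        using germ_map_inv[OF g(1)] \<psi>\<pi> by metis
      then show "\<psi> (ginv \<H> h) = ginv \<G> (\<psi> h)"
        using \<psi>\<pi>[OF g(1)] g by (simp add: sdp_inv)
    qed
    let ?\<B> = "{sdp_basic X r T U m n V | U m n V. m \<in> multi_idx r \<and> n \<in> multi_idx r \<and>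
       open_inj X (P m) U \<and> open_inj X (P n) V}"
    have gtop: "gtop \<G> = topology_generated_by ?\<B>"
      by (simp add: sdp_groupoid_def)
    have "openin (gtop \<H>) (\<psi> -` B \<inter> topspace (gtop \<H>))" if B_mem: "B \<in> ?\<B>" for B
    proof -
      obtain U m n V where B: "B = sdp_basic X r T U m n V"
        and mn: "m \<in> multi_idx r" "n \<in> multi_idx r" "open_inj X (P m) U" "open_inj X (P n) V"
        using B_mem by blast
      have "B \<subseteq> sdp_arrows X r T"
        using sdp_basic_subset[OF mn] B by simp
      \<comment> \<open>Continuity of the inverse reduces to openness of the canonical map, because
        preimages under \<open>\<psi>\<close> are images under \<open>\<pi>\<close>.\<close>
      then have "\<psi> -` B \<inter> arrows \<H> = \<pi> ` B"
        using \<psi>\<pi> \<pi>\<psi> germ_map_in_arrows by (auto simp: image_iff) (metis subsetD)+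
      then show ?thesis
        using germ_map_open[OF mn] B topspace_germ by simp
    qed
    moreover have "\<psi> ` topspace (gtop \<H>) \<subseteq> \<Union>?\<B>"
    proof -
      have "\<Union>?\<B> = topspace (gtop \<G>)"
        unfolding gtop topology_generated_by_topspace ..
      then show ?thesis
        by (simp only: \<psi>_arrows topspace_germ topspace_sdp)
    qed
    ultimately show "continuous_map (gtop \<H>) (gtop \<G>) \<psi>"
      unfolding gtop continuous_on_generated_topo_iff by blast
  qed
  then show ?thesis
    unfolding tgroupoid_iso_def arrows_sdp using germ_map_hom \<psi>\<pi> \<pi>\<psi> by (intro conjI exI[of _ \<psi>]) auto
qed

lemma iso_imp_essentially_free:
  assumes iso: "tgroupoid_iso \<G> \<H> \<pi>"
  shows "essentially_free X r T"
proof (unfold essentially_free_def, intro ballI impI notI)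
  fix m n assume mn: "m \<in> multi_idx r" "n \<in> multi_idx r" "m \<noteq> n"
  assume "\<exists>U. openin X U \<and> U \<noteq> {} \<and> agree_on U (P n) (P m)"
  then obtain x where x: "agree_near X x (P n) (P m)"
    unfolding agree_near_def by blast
  then have "x \<in> topspace X"
    by (metis agree_near_def openin_subset subsetD)
  then have id: "pm_id X x = Some x"
    by (simp add: pm_id_apply)
  \<comment> \<open>Agreement of the two powers near \<open>x\<close> is the relation with exponents
    \<open>m\<close> and \<open>n\<close> for the identity, which also satisfies the one with
    exponents zero. Both arrows over \<open>(x, x)\<close> are therefore sent to the unit germ at
    \<open>x\<close>.\<close>
  have l: "lift m n (pm_id X) x"
    using agree_near_sym[OF x] by (simp add: comp_pm_id pm_on_mpow)
  have l0: "lift (\<lambda>_. 0) (\<lambda>_. 0) (pm_id X) x"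
    using \<open>x \<in> topspace X\<close> by (simp add: mpow_zero comp_pm_id pm_on_pm_id agree_near_refl)
  have "\<pi> (x, idx_diff m n, x) = \<pi> (x, idx_diff (\<lambda>_. 0) (\<lambda>_. 0), x)"
    using germ_map_eq[OF mn(1,2) H_id id l] germ_map_eq[OF multi_idx_zero multi_idx_zero H_id id l0]
    by simp
  moreover have "(x, idx_diff m n, x) \<in> arrows \<G>" "(x, idx_diff (\<lambda>_. 0) (\<lambda>_. 0), x) \<in> arrows \<G>"
    using sdp_arrowsI[OF mn(1,2) id l] sdp_arrowsI[OF multi_idx_zero multi_idx_zero id l0] arrows_sdp
    by simp_all
  ultimately have "(x, idx_diff m n, x) = (x, idx_diff (\<lambda>_. 0) (\<lambda>_. 0), x)"
    using iso unfolding tgroupoid_iso_def by metis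
  then have "idx_diff m n j = 0" for j
    by (simp add: idx_diff_def)
  then show False
    using idx_diff_eq_0D mn(3) by blast
qed

end

theorem proposition1p7:
  fixes X :: "'a topology" and r :: nat and T :: "nat \<Rightarrow> ('a \<rightharpoonup> 'a)"
  assumes "mgds X r T" and "domain_condition X r T"
  shows "essentially_free X r T \<longleftrightarrow>
    tgroupoid_iso (sdp_groupoid X r T) (mgds_germ_groupoid X r T) (germ_map X r T)"
proof -
  interpret mgds_dc X r T
    using assms by unfold_locales
  show ?thesis
    using essentially_free_imp_iso iso_imp_essentially_free by blast
qed

end
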